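(* Let $G=(V,E)$ be a finite bridgeless graph (loops and multiple edges allowed). Then $\varphi(G,q)$ is a polynomial function of degree $n(G)$ of positive integers $q$, and $\bar\varphi(G,q)$ is a polynomial function of degree $n(G)$ of nonnegative integers $q$; denoting the corresponding polynomials by $\varphi(G,t)$ and $\bar\varphi(G,t)$, they satisfy the reciprocity law \[\varphi(G,-t)=(-1)^{n(G)}\bar\varphi(G,t).\] Moreover, \[\varphi(G,t)=\sum_{\rho\in[\mathcal O_{\mathrm{tc}}(G)]}\varphi_\rho(G,t),\qquad \bar\varphi(G,t)=\sum_{\rho\in[\mathcal O_{\mathrm{tc}}(G)]}\bar\varphi_\rho(G,t).\] In particular, $|\varphi(G,-1)|$ equals the number of totally cyclic orientations on $G$, and $|\varphi(G,0)|$ equals the number of Eulerian equivalence classes of totally cyclic orientations on $G$.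
   Context: An orientation of $G$ assigns to each non-loop edge one of its two possible directions (an arrow from one end-vertex to the other) and to each loop one of its two possible directions; formally $\varepsilon(v,e)\in\{\pm1\}$ records whether $e$ points out of ($+1$) or into ($-1$) the end-vertex $v$ of a non-loop edge, and $\varepsilon(v,e)=0$ if $v$ is not an end-vertex of $e$. Let $\mathcal O(G)$ be the set of orientations. For an orientation $\varepsilon$ and abelian group $A$, an $A$-flow of $(G,\varepsilon)$ is $f:E\to A$ with $\sum_{e}m_{v,e}f(e)=0$ for all $v\in V$, where $m_{v,e}=\varepsilon(v,e)$ for non-loop edges and $m_{v,e}=0$ for loops; $F(G,\varepsilon;A)$ is the group of $A$-flows. A flow is nowhere-zero if $f(e)\ne0$ for all $e$. For a positive integer $q$, $\varphi(G,q)$ is the number of nowhere-zero flows of $(G,\varepsilon)$ with values in an abelian group of order $q$ (this is independent of $\varepsilon$ and of the group). $n(G)=|E|-|V|+c(G)$, where $c(G)$ is the number of connected components. A cut is a nonempty edge set $[S,S^c]$ of all edges between a nonempty proper vertex subset $S$ and its complement; it is directed in an orientation if all its edges point from $S$ to $S^c$, or all point from $S^c$ to $S$. An orientation is totally cyclic if it has no directed cut; $\mathcal O_{\mathrm{tc}}(G)$ is the set of totally cyclic orientations. A digraph is directed Eulerian if at every vertex in-degree equals out-degree (a loop contributes one of each). Two orientations $\varepsilon_1,\varepsilon_2$ are Eulerian equivalent ($\varepsilon_1\sim\varepsilon_2$) if the spanning subgraph with edge set $\{e: \varepsilon_1,\varepsilon_2 \text{ differ on } e\}$ is directed Eulerian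 with respect to $\varepsilon_1$ (equivalently $\varepsilon_2$). This is an equivalence relation, and its classes meeting $\mathcal O_{\mathrm{tc}}(G)$ lie inside $\mathcal O_{\mathrm{tc}}(G)$; $[\mathcal O_{\mathrm{tc}}(G)]$ denotes a set containing exactly one representative of each Eulerian equivalence class of totally cyclic orientations. For an orientation $\rho$ and integer $q$, $\varphi_\rho(G,q)=\#\{f\in F(G,\rho;\mathbb Z): 0<f(e)<q\ \forall e\}$ and $\bar\varphi_\rho(G,q)=\#\{f\in F(G,\rho;\mathbb Z): 0\le f(e)\le q\ \forall e\}$; for $\rho$ totally cyclic these are polynomial functions of $q$ (for $q\ge1$, resp. $q\ge0$), whose polynomials are denoted $\varphi_\rho(G,t),\bar\varphi_\rho(G,t)$. Finally $\bar\varphi(G,q)=\#\{(\rho,f): \rho\in[\mathcal O_{\mathrm{tc}}(G)],\ f\in F(G,\rho;\mathbb Z),\ 0\le f(e)\le q\ \forall e\}$. *)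

theory Defs
  imports Main "HOL-Library.FuncSet" "HOL-Computational_Algebra.Polynomial"
begin

text \<open>A finite multigraph (loops and parallel edges allowed): vertex set V, edge set E,
  and for each edge a pair of end-vertices ends e = (u,w). The pair also serves as a
  reference direction u to w. An orientation is encoded by the set R of edges that are
  reversed with respect to the reference direction, so orientations correspond to subsets
  of E (a loop also has two orientations: reversed or not).\<close>

definition graph :: "'v set \<Rightarrow> 'e set \<Rightarrow> ('e \<Rightarrow> 'v \<times> 'v) \<Rightarrow> bool" where
  "graph V E ends \<longleftrightarrow> finite V \<and> finite E \<and> (\<forall>e\<in>E. fst (ends e) \<in> V \<and> snd (ends e) \<in> V)"

definition is_loop :: "('e \<Rightarrow> 'v \<times> 'v) \<Rightarrow> 'e \<Rightarrow> bool" where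
  "is_loop ends e \<longleftrightarrow> fst (ends e) = snd (ends e)"

definition adj :: "'e set \<Rightarrow> ('e \<Rightarrow> 'v \<times> 'v) \<Rightarrow> 'v \<Rightarrow> 'v \<Rightarrow> bool" where
  "adj E ends u w \<longleftrightarrow> (\<exists>e\<in>E. ends e = (u, w) \<or> ends e = (w, u))"

definition ncomp :: "'v set \<Rightarrow> 'e set \<Rightarrow> ('e \<Rightarrow> 'v \<times> 'v) \<Rightarrow> nat" where
  "ncomp V E ends = card {{w \<in> V. (adj E ends)\<^sup>*\<^sup>* u w} | u. u \<in> V}"

definition bridgeless :: "'v set \<Rightarrow> 'e set \<Rightarrow> ('e \<Rightarrow> 'v \<times> 'v) \<Rightarrow> bool" where
  "bridgeless V E ends \<longleftrightarrow> (\<forall>e\<in>E. ncomp V (E - {e}) ends = ncomp V E ends)"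

text \<open>Cyclomatic number n(G) = |E| - |V| + c(G) (always nonnegative).\<close>
definition cyclomatic :: "'v set \<Rightarrow> 'e set \<Rightarrow> ('e \<Rightarrow> 'v \<times> 'v) \<Rightarrow> nat" where
  "cyclomatic V E ends = card E + ncomp V E ends - card V"

definition orientations :: "'e set \<Rightarrow> 'e set set" where
  "orientations E = Pow E"

definition tail :: "('e \<Rightarrow> 'v \<times> 'v) \<Rightarrow> 'e set \<Rightarrow> 'e \<Rightarrow> 'v" where
  "tail ends R e = (if e \<in> R then snd (ends e) else fst (ends e))"

definition head :: "('e \<Rightarrow> 'v \<times> 'v) \<Rightarrow> 'e set \<Rightarrow> 'e \<Rightarrow> 'v" where
  "head ends R e = (if e \<in> R then fst (ends e) else snd (ends e))"

definition inc :: "('e \<Rightarrow> 'v \<times> 'v) \<Rightarrow> 'e set \<Rightarrow> 'v \<Rightarrow> 'e \<Rightarrow> int" where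
  "inc ends R v e = (if is_loop ends e then 0
      else if v = tail ends R e then 1 else if v = head ends R e then -1 else 0)"

definition cut :: "'v set \<Rightarrow> 'e set \<Rightarrow> ('e \<Rightarrow> 'v \<times> 'v) \<Rightarrow> 'v set \<Rightarrow> 'e set" where
  "cut V E ends S = {e \<in> E. (fst (ends e) \<in> S \<and> snd (ends e) \<in> V - S)
                          \<or> (snd (ends e) \<in> S \<and> fst (ends e) \<in> V - S)}"

definition directed_cut :: "'v set \<Rightarrow> 'e set \<Rightarrow> ('e \<Rightarrow> 'v \<times> 'v) \<Rightarrow> 'e set \<Rightarrow> 'v set \<Rightarrow> bool" where
  "directed_cut V E ends R S \<longleftrightarrow> {} \<subset> S \<and> S \<subset> V \<and> cut V E ends S \<noteq> {} \<and>
     ((\<forall>e\<in>cut V E ends S. tail ends R e \<in> S) \<or> (\<forall>e\<in>cut V E ends S. tail ends R e \<in> V - S))"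

definition totally_cyclic :: "'v set \<Rightarrow> 'e set \<Rightarrow> ('e \<Rightarrow> 'v \<times> 'v) \<Rightarrow> 'e set \<Rightarrow> bool" where
  "totally_cyclic V E ends R \<longleftrightarrow> R \<in> orientations E \<and> (\<nexists>S. directed_cut V E ends R S)"

definition tc_orientations :: "'v set \<Rightarrow> 'e set \<Rightarrow> ('e \<Rightarrow> 'v \<times> 'v) \<Rightarrow> 'e set set" where
  "tc_orientations V E ends = {R. totally_cyclic V E ends R}"

definition directed_eulerian :: "'v set \<Rightarrow> ('e \<Rightarrow> 'v \<times> 'v) \<Rightarrow> 'e set \<Rightarrow> 'e set \<Rightarrow> bool" where
  "directed_eulerian V ends R D \<longleftrightarrow>
     (\<forall>v\<in>V. card {e \<in> D. tail ends R e = v} = card {e \<in> D. head ends R e = v})"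

definition eul_equiv :: "'v set \<Rightarrow> 'e set \<Rightarrow> ('e \<Rightarrow> 'v \<times> 'v) \<Rightarrow> 'e set \<Rightarrow> 'e set \<Rightarrow> bool" where
  "eul_equiv V E ends R1 R2 \<longleftrightarrow> R1 \<in> orientations E \<and> R2 \<in> orientations E \<and>
     directed_eulerian V ends R1 ((R1 - R2) \<union> (R2 - R1))"

definition tc_representatives :: "'v set \<Rightarrow> 'e set \<Rightarrow> ('e \<Rightarrow> 'v \<times> 'v) \<Rightarrow> 'e set set \<Rightarrow> bool" where
  "tc_representatives V E ends T \<longleftrightarrow> T \<subseteq> tc_orientations V E ends \<and>
     (\<forall>R\<in>tc_orientations V E ends. \<exists>!\<rho>. \<rho> \<in> T \<and> eul_equiv V E ends R \<rho>)"

definition int_flow :: "'v set \<Rightarrow> 'e set \<Rightarrow> ('e \<Rightarrow> 'v \<times> 'v) \<Rightarrow> 'e set \<Rightarrow> ('e \<Rightarrow> int) \<Rightarrow> bool" where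
  "int_flow V E ends R f \<longleftrightarrow> (\<forall>v\<in>V. (\<Sum>e\<in>E. inc ends R v e * f e) = 0)"

text \<open>phi(G,q): number of nowhere-zero flows with values in the cyclic group Z/qZ
  (an abelian group of order q), w.r.t. the reference orientation (R = {}).
  Elements of Z/qZ are represented by 0..q-1, nonzero ones by 1..q-1.\<close>
definition nzflow_count :: "'v set \<Rightarrow> 'e set \<Rightarrow> ('e \<Rightarrow> 'v \<times> 'v) \<Rightarrow> nat \<Rightarrow> nat" where
  "nzflow_count V E ends q = card {f \<in> E \<rightarrow>\<^sub>E {1..int q - 1}.
      \<forall>v\<in>V. (\<Sum>e\<in>E. inc ends {} v e * f e) mod int q = 0}"

definition phi_rho :: "'v set \<Rightarrow> 'e set \<Rightarrow> ('e \<Rightarrow> 'v \<times> 'v) \<Rightarrow> 'e set \<Rightarrow> nat \<Rightarrow> nat" where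
  "phi_rho V E ends R q = card {f \<in> E \<rightarrow>\<^sub>E {1..int q - 1}. int_flow V E ends R f}"

definition phibar_rho :: "'v set \<Rightarrow> 'e set \<Rightarrow> ('e \<Rightarrow> 'v \<times> 'v) \<Rightarrow> 'e set \<Rightarrow> nat \<Rightarrow> nat" where
  "phibar_rho V E ends R q = card {f \<in> E \<rightarrow>\<^sub>E {0..int q}. int_flow V E ends R f}"

definition phibar :: "'v set \<Rightarrow> 'e set \<Rightarrow> ('e \<Rightarrow> 'v \<times> 'v) \<Rightarrow> 'e set set \<Rightarrow> nat \<Rightarrow> nat" where
  "phibar V E ends T q = card (SIGMA \<rho>:T. {f \<in> E \<rightarrow>\<^sub>E {0..int q}. int_flow V E ends \<rho> f})"

end

theory Submission
  imports Defs
begin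

text \<open>
  Write n(F) for the cyclomatic number of the spanning subgraph with edge set F. There are
  q^n(F) flows modulo q supported on F, so inclusion-exclusion gives
  P(t) = sum over W of (-1)^|W| t^n(E - W), which has degree n(E) when G is bridgeless.

  For disjoint X and Z let t(X,Z) be the number of orientations of Z that carry an integer flow on
  X and Z, positive on Z and arbitrary on X. A convexity argument gives the deletion-contraction
  rule t(X, Z + e) = t(X + e, Z) + t(X, Z) when e is not a bridge of X + Z + e, hence a closed
  formula for t as an alternating sum of signs (-1)^n.
  Rounding a rational flow shows that every flow modulo q lifts to an integer flow in [0,q] for
  some orientation, and that the orientations which occur form an Eulerian equivalence class.
  Consequently the pairs counted by phibar correspond to pairs of a flow g modulo q and an
  orientation counted by t(supp g, E - supp g). Inserting the formula for t yields reciprocity.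

  Polynomiality for a single orientation comes from pulling a vertex v of the flow polytope:
  the points of level q that lie on no facet avoiding v are the translates by v of the points of
  level q - 1, so consecutive counts differ by an alternating sum over proper faces.
\<close>

section \<open>Orientation signs and connectivity\<close>

definition dir_sign :: "'e set \<Rightarrow> 'e \<Rightarrow> int" where
  "dir_sign R e = (if e \<in> R then -1 else 1)"

lemma dir_sign_square [simp]: "dir_sign R e * dir_sign R e = 1"
  "dir_sign R e * (dir_sign R e * x) = x"
  by (auto simp: dir_sign_def)

text \<open>For a loop, tail and head coincide and the two indicators cancel, so the case
  distinction on loops in \<open>inc\<close> disappears.\<close>

lemma inc_eq: "inc ends R v e = of_bool (v = tail ends R e) - of_bool (v = head ends R e)"
  by (auto simp: inc_def is_loop_def tail_def head_def)

text \<open>This moves the orientation out of the incidence numbers and into the signs of the flow: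
  all later conservation laws refer to the reference orientation \<open>{}\<close>.\<close>

lemma inc_dir_sign: "inc ends R v e = inc ends {} v e * dir_sign R e"
  by (auto simp: inc_eq tail_def head_def dir_sign_def)

lemma adj_sym: "adj F ends u w \<Longrightarrow> adj F ends w u"
  by (auto simp: adj_def)

lemma connected_sym: "(adj F ends)\<^sup>*\<^sup>* u w \<Longrightarrow> (adj F ends)\<^sup>*\<^sup>* w u"
  by (induction rule: rtranclp_induct) (auto intro: converse_rtranclp_into_rtranclp adj_sym)

lemma connected_mono:
  assumes "F \<subseteq> F'" "(adj F ends)\<^sup>*\<^sup>* u w"
  shows "(adj F' ends)\<^sup>*\<^sup>* u w"
proof -
  have "adj F ends \<le> adj F' ends" using assms(1) unfolding adj_def by blast
  from rtranclp_mono[OF this] assms(2) show ?thesis by auto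
qed

lemma connected_edge: "e \<in> F \<Longrightarrow> (adj F ends)\<^sup>*\<^sup>* (fst (ends e)) (snd (ends e))"
  by (rule r_into_rtranclp) (auto simp: adj_def intro!: bexI[of _ e])

text \<open>A walk that uses \<open>e\<close> repeatedly can be cut down to one that uses it at most
  once, in one of its two directions.\<close>

lemma connected_insert_iff:
  "(adj (insert e F) ends)\<^sup>*\<^sup>* u w \<longleftrightarrow> (adj F ends)\<^sup>*\<^sup>* u w
     \<or> (adj F ends)\<^sup>*\<^sup>* u (fst (ends e)) \<and> (adj F ends)\<^sup>*\<^sup>* (snd (ends e)) w
     \<or> (adj F ends)\<^sup>*\<^sup>* u (snd (ends e)) \<and> (adj F ends)\<^sup>*\<^sup>* (fst (ends e)) w"
  (is "?L \<longleftrightarrow> ?R w")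
proof
  assume ?L
  then show "?R w"
  proof (induction rule: rtranclp_induct)
    case base
    then show ?case by simp
  next
    case (step y z)
    from step.hyps(2) consider "adj F ends y z" | "ends e = (y, z)" | "ends e = (z, y)"
      by (auto simp: adj_def)
    then show ?case
    proof cases
      case 1
      with step.IH show ?thesis by (meson rtranclp.rtrancl_into_rtrancl)
    next
      case 2
      with step.IH show ?thesis
        by (auto intro: rtranclp_trans)
    next
      case 3
      with step.IH show ?thesis
        by (auto intro: rtranclp_trans)
    qed
  qed
next
  have m: "(adj F ends)\<^sup>*\<^sup>* a b \<Longrightarrow> (adj (insert e F) ends)\<^sup>*\<^sup>* a b" for a b
    by (rule connected_mono) auto
  have ed: "(adj (insert e F) ends)\<^sup>*\<^sup>* (fst (ends e)) (snd (ends e))"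
    by (rule connected_edge) simp
  assume "?R w"
  then show ?L
    using m ed connected_sym[OF ed] by (meson rtranclp_trans)
qed

section \<open>The boundary map and integer circulations\<close>

locale multigraph =
  fixes V :: "'v set" and E :: "'e set" and ends :: "'e \<Rightarrow> 'v \<times> 'v"
  assumes graph: "graph V E ends"
begin

lemma finite_V [simp]: "finite V" and finite_E [simp]: "finite E"
  using graph by (auto simp: graph_def)

lemma ends_in_V [simp]: "e \<in> E \<Longrightarrow> fst (ends e) \<in> V" "e \<in> E \<Longrightarrow> snd (ends e) \<in> V"
  using graph by (auto simp: graph_def)

lemma finite_subset_E: "F \<subseteq> E \<Longrightarrow> finite F"
  using finite_subset finite_E by blast

abbreviation conn :: "'e set \<Rightarrow> 'v \<Rightarrow> 'v \<Rightarrow> bool" where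
  "conn F \<equiv> (adj F ends)\<^sup>*\<^sup>*"

text \<open>The boundary map of the reference orientation. The coefficient ring is left open because
  rounding works with rational values and the remaining arguments with integers.\<close>

definition net :: "('e \<Rightarrow> 'a::comm_ring_1) \<Rightarrow> 'v \<Rightarrow> 'a" where
  "net x v = (\<Sum>e\<in>E. of_int (inc ends {} v e) * x e)"

lemma net_cong: "(\<And>e. e \<in> E \<Longrightarrow> x e = y e) \<Longrightarrow> net x v = net y v"
  by (auto simp: net_def intro: sum.cong)

lemma net_zero [simp]: "net (\<lambda>e. 0) v = 0"
  by (simp add: net_def)

lemma net_add: "net (\<lambda>e. x e + y e) v = net x v + net y v"
  by (simp add: net_def sum.distrib algebra_simps)

lemma net_diff: "net (\<lambda>e. x e - y e) v = net x v - net y v"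
  by (simp add: net_def sum_subtractf algebra_simps)

lemma net_scale: "net (\<lambda>e. c * x e) v = c * net x v"
  by (simp add: net_def sum_distrib_left algebra_simps)

lemma net_sum: "finite I \<Longrightarrow> net (\<lambda>e. \<Sum>i\<in>I. x i e) v = (\<Sum>i\<in>I. net (x i) v)"
  by (induction I rule: finite_induct) (auto simp: net_add)

lemma net_of_int: "net (\<lambda>e. of_int (x e)) v = of_int (net x v)"
  by (simp add: net_def)

lemma net_single: "e \<in> E \<Longrightarrow> net (\<lambda>e'. of_bool (e' = e) * c) v = of_int (inc ends {} v e) * c"
proof -
  assume "e \<in> E"
  have "net (\<lambda>e'. of_bool (e' = e) * c) v = (\<Sum>e'\<in>E. if e' = e then of_int (inc ends {} v e) * c else 0)"
    unfolding net_def by (intro sum.cong) auto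
  with \<open>e \<in> E\<close> show ?thesis by simp
qed

text \<open>A discrete divergence theorem: an edge inside \<open>S\<close> is counted with opposite
  signs at its two ends, so only edges of the cut survive.\<close>

lemma sum_net:
  assumes "finite S"
  shows "(\<Sum>v\<in>S. net x v) = (\<Sum>e\<in>E. (of_bool (fst (ends e) \<in> S) - of_bool (snd (ends e) \<in> S)) * x e)"
proof -
  have *: "(\<Sum>v\<in>S. of_bool (v = a)) = (of_bool (a \<in> S) :: 'c::comm_ring_1)" for a
    using assms by (simp add: of_bool_def sum.delta')
  have "(\<Sum>v\<in>S. net x v) = (\<Sum>e\<in>E. \<Sum>v\<in>S. of_int (inc ends {} v e) * x e)"
    unfolding net_def by (rule sum.swap)
  also have "\<dots> = (\<Sum>e\<in>E. (of_bool (fst (ends e) \<in> S) - of_bool (snd (ends e) \<in> S)) * x e)"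
    by (intro sum.cong refl)
      (simp add: inc_eq tail_def head_def sum_distrib_right[symmetric] sum_subtractf *)
  finally show ?thesis .
qed

lemma int_flow_iff:
  "int_flow V E ends R f \<longleftrightarrow> (\<forall>v\<in>V. net (\<lambda>e. dir_sign R e * f e) v = 0)"
  by (simp add: int_flow_def net_def inc_dir_sign[of ends R] mult.assoc)

text \<open>A walk from \<open>u\<close> to \<open>w\<close> read as a unit flow, where an edge run
  against its reference direction counts -1.\<close>

lemma path_exists:
  assumes "F \<subseteq> E" "conn F u w"
  shows "\<exists>p :: 'e \<Rightarrow> int. (\<forall>e. e \<notin> F \<longrightarrow> p e = 0) \<and> (\<forall>v. net p v = of_bool (v = u) - of_bool (v = w))"
  using assms(2)
proof (induction rule: rtranclp_induct)
  case base
  show ?case by (intro exI[of _ "\<lambda>_. 0"]) auto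
next
  case (step y z)
  then obtain p :: "'e \<Rightarrow> int" where p: "\<forall>e. e \<notin> F \<longrightarrow> p e = 0"
    "\<And>v. net p v = of_bool (v = u) - of_bool (v = y)" by auto
  from step.hyps(2) obtain e where e: "e \<in> F" "ends e = (y, z) \<or> ends e = (z, y)"
    by (auto simp: adj_def)
  define s :: int where "s = (if ends e = (y, z) then 1 else -1)"
  define p' where "p' = (\<lambda>e'. p e' + of_bool (e' = e) * s)"
  have "inc ends {} v e * s = of_bool (v = y) - of_bool (v = z)" for v
    using e(2) by (cases "ends e = (y, z)") (auto simp: inc_eq tail_def head_def s_def)
  then have "net p' v = of_bool (v = u) - of_bool (v = z)" for v
    using e(1) assms(1) unfolding p'_def net_add p(2) by (simp add: net_single subsetD)
  moreover have "\<forall>e'. e' \<notin> F \<longrightarrow> p' e' = 0" using p e by (auto simp: p'_def)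
  ultimately show ?case by blast
qed

text \<open>The fundamental cycle of \<open>e\<close>: a path in \<open>F\<close> from the second
  end back to the first, closed by \<open>e\<close> itself.\<close>

lemma cycle_through:
  assumes "F \<subseteq> E" "e \<in> E" "e \<notin> F" "conn F (fst (ends e)) (snd (ends e))"
  shows "\<exists>y :: 'e \<Rightarrow> int. y e = 1 \<and> (\<forall>e'. e' \<notin> insert e F \<longrightarrow> y e' = 0) \<and> (\<forall>v. net y v = 0)"
proof -
  from path_exists[OF assms(1) connected_sym[OF assms(4)]]
  obtain p :: "'e \<Rightarrow> int" where p: "\<forall>e. e \<notin> F \<longrightarrow> p e = 0"
    "\<And>v. net p v = of_bool (v = snd (ends e)) - of_bool (v = fst (ends e))" by auto
  define y where "y = (\<lambda>e'. p e' + of_bool (e' = e) * 1)"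
  have "net y v = 0" for v
    unfolding y_def net_add net_single[OF assms(2)] p(2) by (simp add: inc_eq tail_def head_def)
  moreover have "y e = 1" "\<forall>e'. e' \<notin> insert e F \<longrightarrow> y e' = 0" using p assms(3) by (auto simp: y_def)
  ultimately show ?thesis by blast
qed

text \<open>\<open>S\<close> is a component of \<open>F\<close>, so no edge of \<open>F\<close>
  crosses its boundary, while \<open>e\<close> does. The value on a bridge is thus controlled by the
  edges outside \<open>insert e F\<close>; later these values are integral or zero.\<close>

lemma sum_net_bridge:
  fixes x :: "'e \<Rightarrow> 'a::comm_ring_1"
  assumes "F \<subseteq> E" "e \<in> E" "e \<notin> F" "\<not> conn F (fst (ends e)) (snd (ends e))"
  defines "S \<equiv> {w \<in> V. conn F (fst (ends e)) w}"
  shows "(\<Sum>v\<in>S. net x v) = x e + (\<Sum>e'\<in>E - insert e F.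
    (of_bool (fst (ends e') \<in> S) - of_bool (snd (ends e') \<in> S)) * x e')"
proof -
  have fin: "finite S" by (simp add: S_def)
  have 0: "fst (ends e') \<in> S \<longleftrightarrow> snd (ends e') \<in> S" if "e' \<in> F" for e'
  proof -
    have "conn F (fst (ends e')) (snd (ends e'))" by (rule connected_edge[OF that])
    then show ?thesis using assms(1) that unfolding S_def
      by (auto intro: rtranclp_trans connected_sym)
  qed
  have 1: "fst (ends e) \<in> S" "snd (ends e) \<notin> S" using assms by (auto simp: S_def)
  have fF: "finite F" by (rule finite_subset_E[OF assms(1)])
  have "(\<Sum>v\<in>S. net x v) = (\<Sum>e\<in>E. (of_bool (fst (ends e) \<in> S) - of_bool (snd (ends e) \<in> S)) * x e)"
    by (rule sum_net[OF fin])
  also have "\<dots> = (\<Sum>e\<in>insert e F. (of_bool (fst (ends e) \<in> S) - of_bool (snd (ends e) \<in> S)) * x e)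
    + (\<Sum>e'\<in>E - insert e F. (of_bool (fst (ends e') \<in> S) - of_bool (snd (ends e') \<in> S)) * x e')"
    using assms(1,2) by (subst sum.subset_diff[of "insert e F"]) (auto simp: add.commute)
  also have "(\<Sum>e\<in>insert e F. (of_bool (fst (ends e) \<in> S) - of_bool (snd (ends e) \<in> S)) * x e) = x e"
    using 0 1 fF assms(3) by (subst sum.insert) (auto intro: sum.neutral)
  finally show ?thesis .
qed

subsection \<open>The cyclomatic number\<close>

lemma ncomp_image: "ncomp V F ends = card ((\<lambda>u. {w \<in> V. conn F u w}) ` V)"
  unfolding ncomp_def by (rule arg_cong[where f = card]) auto

lemma ncomp_insert_connected:
  assumes "conn F (fst (ends e)) (snd (ends e))"
  shows "ncomp V (insert e F) ends = ncomp V F ends"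
proof -
  have "conn (insert e F) u w \<longleftrightarrow> conn F u w" for u w
    unfolding connected_insert_iff using assms connected_sym[OF assms] by (meson rtranclp_trans)
  then show ?thesis by (simp add: ncomp_image)
qed

text \<open>The components of the two ends of \<open>e\<close> merge into one and all others
  persist.\<close>

lemma ncomp_insert_bridge:
  assumes "e \<in> E" "\<not> conn F (fst (ends e)) (snd (ends e))"
  shows "ncomp V F ends = Suc (ncomp V (insert e F) ends)"
proof -
  define C where "C = (\<lambda>u. {w \<in> V. conn F u w})"
  define D where "D = (\<lambda>u. {w \<in> V. conn (insert e F) u w})"
  define a b where "a = fst (ends e)" and "b = snd (ends e)"
  have ab: "a \<in> V" "b \<in> V" "\<not> conn F a b" using assms by (auto simp: a_def b_def)
  have C_eq: "C u = C w \<longleftrightarrow> conn F u w" if "w \<in> V" for u w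
    using that unfolding C_def by (auto intro: rtranclp_trans connected_sym)
  \<comment> \<open>\<open>C\<close> and \<open>D\<close> send a vertex to its component before and
    after the insertion; every new component is expressed by old ones.\<close>
  have D: "D u = (if C u = C a \<or> C u = C b then C a \<union> C b else C u)" if "u \<in> V" for u
    unfolding D_def connected_insert_iff C_eq[OF ab(1)] C_eq[OF ab(2)] a_def[symmetric] b_def[symmetric]
    unfolding C_def using ab that by (auto intro: rtranclp_trans connected_sym)
  have ne: "C a \<noteq> C b" using C_eq ab by auto
  have new: "C a \<union> C b \<notin> C ` V"
  proof
    assume "C a \<union> C b \<in> C ` V"
    then obtain u where u: "u \<in> V" "C u = C a \<union> C b" by auto
    then have "conn F u a" "conn F u b" using ab by (auto simp: C_def)
    then show False using ab by (meson connected_sym rtranclp_trans)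
  qed
  have "D ` V = insert (C a \<union> C b) (C ` V - {C a, C b})"
  proof -
    have "D u \<in> insert (C a \<union> C b) (C ` V - {C a, C b})" if "u \<in> V" for u
      using D[OF that] that by auto
    moreover have "C a \<union> C b \<in> D ` V" using D[OF ab(1)] ab(1) by (auto intro!: image_eqI[of _ D a])
    moreover have "C u \<in> D ` V" if "u \<in> V" "C u \<noteq> C a" "C u \<noteq> C b" for u
      using D[OF that(1)] that by (auto intro!: image_eqI[of _ D u])
    ultimately show ?thesis by auto
  qed
  then have "card (D ` V) = Suc (card (C ` V - {C a, C b}))"
    using new by (simp add: card_insert_disjoint)
  moreover have "card (C ` V - {C a, C b}) = card (C ` V) - 2"
    using ab ne by (subst card_Diff_subset) auto
  moreover have "card {C a, C b} \<le> card (C ` V)"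
    using ab by (intro card_mono) auto
  ultimately show ?thesis using ne by (simp add: ncomp_image C_def D_def)
qed

text \<open>Each new edge lowers the number of components by at most one. This makes the truncated
  subtraction in \<open>cyclomatic\<close> exact.\<close>

lemma card_V_le: "F \<subseteq> E \<Longrightarrow> card V \<le> card F + ncomp V F ends"
proof -
  assume "F \<subseteq> E"
  with finite_subset_E[OF this] show ?thesis
  proof (induction F rule: finite_induct)
    case empty
    have "(\<lambda>u. {w \<in> V. conn {} u w}) ` V = (\<lambda>u. {u}) ` V"
    proof (intro image_cong refl)
      fix u assume "u \<in> V"
      have "conn {} u w \<Longrightarrow> w = u" for w
        by (induction rule: rtranclp_induct) (auto simp: adj_def)
      with \<open>u \<in> V\<close> show "{w \<in> V. conn {} u w} = {u}" by auto
    qed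
    then show ?case by (simp add: ncomp_image card_image)
  next
    case (insert e F)
    then show ?case
      using ncomp_insert_connected[of F e] ncomp_insert_bridge[of e F]
      by (cases "conn F (fst (ends e)) (snd (ends e))") auto
  qed
qed

abbreviation nullity :: "'e set \<Rightarrow> nat" where
  "nullity F \<equiv> cyclomatic V F ends"

lemma cyclomatic_empty: "nullity {} = 0"
proof -
  have "card ((\<lambda>u. {w \<in> V. conn {} u w}) ` V) \<le> card V"
    by (rule card_image_le) simp
  then show ?thesis by (simp add: cyclomatic_def ncomp_image)
qed

text \<open>The recursion behind the later inductions over edge sets: an edge raises the nullity
  exactly when it closes a cycle.\<close>

lemma cyclomatic_insert:
  assumes "e \<in> E" "F \<subseteq> E" "e \<notin> F"
  shows "nullity (insert e F) = nullity F + of_bool (conn F (fst (ends e)) (snd (ends e)))"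
  using card_V_le[OF assms(2)] finite_subset_E[OF assms(2)] assms
    ncomp_insert_connected[of F e] ncomp_insert_bridge[of e F]
  by (auto simp: cyclomatic_def)

lemma cyclomatic_mono:
  assumes "F \<subseteq> F'" "F' \<subseteq> E"
  shows "nullity F \<le> nullity F'"
proof -
  have "finite (F' - F)" using finite_subset_E[OF assms(2)] by simp
  then have "F' - F = D \<Longrightarrow> nullity F \<le> nullity F'" for D
    using assms
  proof (induction "F' - F" arbitrary: F' D rule: finite_psubset_induct)
    case psubset
    show ?case
    proof (cases "F' = F")
      case False
      then obtain e where e: "e \<in> F' - F" using psubset.prems by auto
      have "nullity F \<le> nullity (F' - {e})"
        by (rule psubset.hyps(2)[OF _ refl]) (use psubset.prems e in auto)
      also have "\<dots> \<le> nullity (insert e (F' - {e}))"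
        using e psubset.prems by (subst cyclomatic_insert) auto
      finally show ?thesis using e by (simp add: insert_absorb)
    qed simp
  qed
  then show ?thesis by simp
qed

lemma bridgeless_connected:
  assumes "bridgeless V E ends" "e \<in> E"
  shows "conn (E - {e}) (fst (ends e)) (snd (ends e))"
  using assms ncomp_insert_bridge[of e "E - {e}"]
  by (auto simp: bridgeless_def insert_absorb)

text \<open>Some edge outside \<open>F\<close> closes a cycle with all the others. The strict
  inequality isolates the leading term of the flow polynomial.\<close>

lemma bridgeless_cyclomatic_less:
  assumes "bridgeless V E ends" "F \<subset> E"
  shows "nullity F < nullity E"
proof -
  obtain e where e: "e \<in> E" "e \<notin> F" using assms(2) by auto
  have "nullity F \<le> nullity (E - {e})" by (rule cyclomatic_mono) (use assms e in auto)
  also have "\<dots> < nullity (insert e (E - {e}))"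
    using cyclomatic_insert[of e "E - {e}"] bridgeless_connected[OF assms(1) e(1)] e by auto
  finally show ?thesis using e by (simp add: insert_absorb)
qed


subsection \<open>Rounding\<close>

text \<open>If \<open>e\<close> were a bridge of the set of fractional edges, conservation across
  the resulting cut would write \<open>x e\<close> as a combination of integers. So \<open>e\<close>
  lies on a cycle of fractional edges.\<close>

lemma circulation_on_fractional_edges:
  fixes x :: "'e \<Rightarrow> rat"
  assumes "\<And>v. v \<in> V \<Longrightarrow> net x v \<in> \<int>" and "e \<in> E" "x e \<notin> \<int>"
  shows "\<exists>y :: 'e \<Rightarrow> int. y e = 1 \<and> (\<forall>e'\<in>E. x e' \<in> \<int> \<longrightarrow> y e' = 0) \<and> (\<forall>v. net y v = 0)"
proof -
  define F where "F = {e'\<in>E. x e' \<notin> \<int>} - {e}"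
  have F: "F \<subseteq> E" "e \<notin> F" by (auto simp: F_def)
  have "conn F (fst (ends e)) (snd (ends e))"
  proof (rule ccontr)
    assume nc: "\<not> conn F (fst (ends e)) (snd (ends e))"
    define S where "S = {w \<in> V. conn F (fst (ends e)) w}"
    have "x e = (\<Sum>v\<in>S. net x v) - (\<Sum>e'\<in>E - insert e F.
        (of_bool (fst (ends e') \<in> S) - of_bool (snd (ends e') \<in> S)) * x e')"
      using sum_net_bridge[OF F(1) assms(2) F(2) nc, of x] by (simp add: S_def)
    also have "\<dots> \<in> \<int>"
      using assms by (intro Ints_diff Ints_sum Ints_mult) (auto simp: S_def F_def)
    finally show False using assms(3) by simp
  qed
  from cycle_through[OF F(1) assms(2) F(2) this] show ?thesis using assms(3)
    by (auto simp: F_def)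
qed

text \<open>Moving along a circulation supported on fractional edges, until one of them reaches an
  integer, lowers their number without changing \<open>net\<close> or leaving the floor-ceiling
  intervals.\<close>

lemma integral_rounding:
  fixes x :: "'e \<Rightarrow> rat"
  assumes "\<And>v. v \<in> V \<Longrightarrow> net x v \<in> \<int>"
  shows "\<exists>z :: 'e \<Rightarrow> int. (\<forall>e\<in>E. \<lfloor>x e\<rfloor> \<le> z e \<and> z e \<le> \<lceil>x e\<rceil>) \<and> (\<forall>v\<in>V. of_int (net z v) = net x v)"
  using assms
proof (induction "card {e\<in>E. x e \<notin> \<int>}" arbitrary: x rule: less_induct)
  case less
  show ?case
  proof (cases "\<exists>e\<in>E. x e \<notin> \<int>")
    case False
    have "net x v = of_int (net (\<lambda>e. \<lfloor>x e\<rfloor>) v)" for v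
      unfolding net_of_int[symmetric] using False by (intro net_cong) (auto elim: Ints_cases)
    then show ?thesis by (intro exI[of _ "\<lambda>e. \<lfloor>x e\<rfloor>"]) (auto intro: order_trans[OF floor_le_ceiling])
  next
    case True
    then obtain e0 where e0: "e0 \<in> E" "x e0 \<notin> \<int>" by auto
    obtain y :: "'e \<Rightarrow> int" where y: "y e0 = 1" "\<And>e. e \<in> E \<Longrightarrow> x e \<in> \<int> \<Longrightarrow> y e = 0" "\<And>v. net y v = 0"
      using circulation_on_fractional_edges[OF less.prems e0] by auto
    define S where "S = {e\<in>E. y e \<noteq> 0}"
    \<comment> \<open>the largest multiple of y that can be added before e crosses an integer\<close>
    define slack where "slack e = (if y e > 0 then (of_int \<lceil>x e\<rceil> - x e) / of_int (y e)
        else (x e - of_int \<lfloor>x e\<rfloor>) / of_int (- y e))" for e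
    define k where "k = Min (slack ` S)"
    have S: "finite S" "e0 \<in> S" using e0 y by (auto simp: S_def)
    obtain e1 where e1: "e1 \<in> S" "slack e1 = k"
      using Min_in[of "slack ` S"] S unfolding k_def by (metis empty_iff finite_imageI image_iff)
    have k_le: "k \<le> slack e" if "e \<in> S" for e
      using that S unfolding k_def by auto
    have k0: "0 \<le> k" using e1 unfolding slack_def
      by (auto simp: S_def split: if_splits intro!: divide_nonneg_nonneg divide_nonneg_neg simp: divide_nonpos_neg)
    define x' where "x' e = x e + k * of_int (y e)" for e
    have bounds: "of_int \<lfloor>x e\<rfloor> \<le> x' e \<and> x' e \<le> of_int \<lceil>x e\<rceil>" if "e \<in> E" for e
    proof (cases "y e = 0")
      case True
      then show ?thesis by (simp add: x'_def)
    next
      case False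
      then have ke: "k \<le> slack e" using k_le that by (auto simp: S_def)
      have fc: "of_int \<lfloor>x e\<rfloor> \<le> x e" "x e \<le> of_int \<lceil>x e\<rceil>" by auto
      show ?thesis
      proof (cases "y e > 0")
        case True
        then have "k * of_int (y e) \<le> of_int \<lceil>x e\<rceil> - x e"
          using ke by (simp add: slack_def field_simps)
        moreover have "0 \<le> k * of_int (y e)" using k0 True by auto
        ultimately show ?thesis using fc unfolding x'_def by linarith
      next
        case neg: False
        then have "of_int (- y e) > (0::rat)" using False by auto
        then have "k * of_int (- y e) \<le> x e - of_int \<lfloor>x e\<rfloor>"
          using ke neg by (simp add: slack_def field_simps)
        moreover have "0 \<le> k * of_int (- y e)" using k0 neg by (intro mult_nonneg_nonneg) auto
        ultimately show ?thesis using fc unfolding x'_def of_int_minus mult_minus_right by linarith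
      qed
    qed
    have net': "net x' v = net x v" for v
      unfolding x'_def net_add net_scale net_of_int y(3) by simp
    have int': "x' e \<in> \<int>" if "e \<in> E" "x e \<in> \<int>" for e
      using that y(2) by (simp add: x'_def)
    \<comment> \<open>The edge attaining the minimum slack stops exactly at its floor or its
      ceiling.\<close>
    have "x' e1 = of_int \<lceil>x e1\<rceil> \<or> x' e1 = of_int \<lfloor>x e1\<rfloor>"
      using e1 unfolding x'_def e1(2)[symmetric] by (auto simp: slack_def S_def)
    then have "x' e1 \<in> \<int>" by auto
    moreover have "x e1 \<notin> \<int>" "e1 \<in> E" using e1(1) y(2) by (auto simp: S_def)
    ultimately have "{e\<in>E. x' e \<notin> \<int>} \<subset> {e\<in>E. x e \<notin> \<int>}" using int' by blast
    then have "card {e\<in>E. x' e \<notin> \<int>} < card {e\<in>E. x e \<notin> \<int>}" by (intro psubset_card_mono) auto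
    from less.hyps[OF this] less.prems obtain z where
      z: "\<And>e. e \<in> E \<Longrightarrow> \<lfloor>x' e\<rfloor> \<le> z e \<and> z e \<le> \<lceil>x' e\<rceil>" "\<And>v. v \<in> V \<Longrightarrow> of_int (net z v) = net x' v"
      unfolding net' by auto
    have "\<lfloor>x e\<rfloor> \<le> z e \<and> z e \<le> \<lceil>x e\<rceil>" if "e \<in> E" for e
      using z(1)[OF that] bounds[OF that] by (meson ceiling_le_iff le_floor_iff order_trans)
    then show ?thesis using z(2) net' by auto
  qed
qed

text \<open>Rounding of \<open>g / q\<close>. It serves twice: to lift a flow modulo q to an integer
  flow, and to find a lattice point at level 1 from one at level q.\<close>

lemma integral_rounding_scaled:
  assumes q: "q > 0" and dvd: "\<And>v. v \<in> V \<Longrightarrow> q dvd net g v"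
  shows "\<exists>z :: 'e \<Rightarrow> int. (\<forall>e\<in>E. \<lfloor>of_int (g e) / of_int q :: rat\<rfloor> \<le> z e \<and> z e \<le> \<lceil>of_int (g e) / of_int q :: rat\<rceil>)
    \<and> (\<forall>v\<in>V. q * net z v = net g v)"
proof -
  define x :: "'e \<Rightarrow> rat" where "x e = of_int (g e) / of_int q" for e
  have x: "net x v = of_int (net g v) / of_int q" for v
    using net_scale[of "1 / of_int q" "\<lambda>e. rat_of_int (g e)" v] by (simp add: x_def[abs_def] net_of_int)
  have "net x v \<in> \<int>" if "v \<in> V" for v
    using dvd[OF that] q unfolding x by (auto elim!: dvdE)
  from integral_rounding[OF this] obtain z where
    z: "\<forall>e\<in>E. \<lfloor>x e\<rfloor> \<le> z e \<and> z e \<le> \<lceil>x e\<rceil>" "\<And>v. v \<in> V \<Longrightarrow> of_int (net z v) = net x v" by auto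
  have "q * net z v = net g v" if "v \<in> V" for v
  proof -
    have "rat_of_int (q * net z v) = of_int (net g v)" using z(2)[OF that] q by (simp add: x)
    then show ?thesis by (simp only: of_int_eq_iff)
  qed
  then show ?thesis using z(1) by (auto simp: x_def)
qed

subsection \<open>Flows modulo q\<close>

definition mod_flows :: "nat \<Rightarrow> ('e \<Rightarrow> int) set" where
  "mod_flows q = {g \<in> E \<rightarrow>\<^sub>E {0..int q - 1}. \<forall>v\<in>V. int q dvd net g v}"

lemma finite_mod_flows [simp]: "finite (mod_flows q)"
  by (rule finite_subset[of _ "E \<rightarrow>\<^sub>E {0..int q - 1}"]) (auto simp: mod_flows_def intro!: finite_PiE)

lemma net_mod_dvd_iff:
  fixes x y :: "'e \<Rightarrow> int"
  assumes "\<And>e. e \<in> E \<Longrightarrow> d dvd x e - y e"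
  shows "d dvd net x v \<longleftrightarrow> d dvd net y v"
proof -
  have "d dvd net (\<lambda>e. x e - y e) v"
    unfolding net_def by (intro dvd_sum) (use assms in auto)
  then show ?thesis unfolding net_diff by (metis diff_add_cancel dvd_add_right_iff)
qed

text \<open>Induction on \<open>F\<close>. An edge closing a cycle carries a free value, removable
  by a multiple of that cycle, so the count gains a factor q; a bridge must carry 0. Both cases
  match \<open>cyclomatic_insert\<close>.\<close>

lemma card_mod_flows_supported:
  assumes q: "q \<ge> 1" and "F \<subseteq> E"
  shows "card {g \<in> mod_flows q. \<forall>e\<in>E - F. g e = 0} = q ^ nullity F"
  using finite_subset_E[OF assms(2)] assms(2)
proof (induction F rule: finite_induct)
  case empty
  have "{g \<in> mod_flows q. \<forall>e\<in>E - {}. g e = 0} = {\<lambda>e\<in>E. 0}"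
  proof -
    have "net (\<lambda>e\<in>E. 0 :: int) v = 0" for v by (subst net_cong[of _ "\<lambda>_. 0"]) auto
    then show ?thesis using q by (auto simp: mod_flows_def PiE_iff extensional_def)
  qed
  then show ?case by (simp add: cyclomatic_empty)
next
  case (insert e F)
  then have F: "F \<subseteq> E" "e \<in> E" "e \<notin> F" by auto
  let ?M = "\<lambda>F. {g \<in> mod_flows q. \<forall>e\<in>E - F. g e = 0}"
  show ?case
  proof (cases "conn F (fst (ends e)) (snd (ends e))")
    case True
    obtain y :: "'e \<Rightarrow> int" where y: "y e = 1" "\<And>e'. e' \<notin> insert e F \<Longrightarrow> y e' = 0" "\<And>v. net y v = 0"
      using cycle_through[OF F True] by auto
    \<comment> \<open>Adding a multiple of the cycle stays among the flows modulo q. With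
      \<open>c = - g e\<close> it clears the value at \<open>e\<close>, because
      \<open>y e = 1\<close>.\<close>
    have red: "(\<lambda>e'\<in>E. (g e' + c * y e') mod int q) \<in> mod_flows q" if "g \<in> mod_flows q" for g c
    proof -
      have "int q dvd net (\<lambda>e'\<in>E. (g e' + c * y e') mod int q) v" if "v \<in> V" for v
      proof -
        have "int q dvd net (\<lambda>e'\<in>E. (g e' + c * y e') mod int q) v \<longleftrightarrow> int q dvd net (\<lambda>e'. g e' + c * y e') v"
          by (rule net_mod_dvd_iff) (simp add: mod_eq_dvd_iff[symmetric])
        also have "net (\<lambda>e'. g e' + c * y e') v = net g v" by (simp add: net_add net_scale y)
        finally have "int q dvd net (\<lambda>e'\<in>E. (g e' + c * y e') mod int q) v \<longleftrightarrow> int q dvd net g v" .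
        moreover have "int q dvd net g v" using \<open>g \<in> mod_flows q\<close> that by (simp add: mod_flows_def)
        ultimately show ?thesis by blast
      qed
      then show ?thesis using q by (auto simp: mod_flows_def)
    qed
    have rng: "g e' mod int q = g e'" if "g \<in> mod_flows q" "e' \<in> E" for g e'
      using that by (auto simp: mod_flows_def PiE_iff)
    have ext: "g e' = undefined" if "g \<in> mod_flows q" "e' \<notin> E" for g e'
      using that by (auto simp: mod_flows_def PiE_iff extensional_def)
    have "bij_betw (\<lambda>g. (g e, \<lambda>e'\<in>E. (g e' + (- g e) * y e') mod int q))
        (?M (insert e F)) ({0..int q - 1} \<times> ?M F)"
    proof (rule bij_betw_byWitness[where f' = "\<lambda>(c, g). \<lambda>e'\<in>E. (g e' + c * y e') mod int q"], goal_cases)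
      case 1
      show ?case
        by (auto simp: fun_eq_iff restrict_def mod_simps rng ext)
    next
      case 2
      have "c = (g e + c * y e) mod int q" if "g \<in> ?M F" "c \<in> {0..int q - 1}" for g c
        using that F y(1) by auto
      moreover have "(((g e' + c * y e') mod int q) + (- c) * y e') mod int q = g e'"
        if "g \<in> ?M F" "e' \<in> E" for g e' c
        using rng[of g e'] that by (simp add: mod_simps)
      ultimately show ?case
        using F by (auto simp: fun_eq_iff restrict_def ext)
    next
      case 3
      have "(g e, \<lambda>e'\<in>E. (g e' + (- g e) * y e') mod int q) \<in> {0..int q - 1} \<times> ?M F"
        if g: "g \<in> ?M (insert e F)" for g
      proof -
        have "(g e' + (- g e) * y e') mod int q = 0" if "e' \<in> E - F" for e'
          using that g y(1) y(2)[of e'] by (cases "e' = e") auto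
        moreover have "g e \<in> {0..int q - 1}" using g F by (auto simp: mod_flows_def PiE_iff)
        ultimately show ?thesis using red[of g "- g e"] g by simp
      qed
      then show ?case by blast
    next
      case 4
      have "(\<lambda>e'\<in>E. (g e' + c * y e') mod int q) \<in> ?M (insert e F)" if g: "g \<in> ?M F" for g c
        using red[of g c] g y(2) by simp
      then show ?case by (intro image_subsetI) (simp only: mem_Times_iff case_prod_beta)
    qed
    then have "card (?M (insert e F)) = card ({0..int q - 1} \<times> ?M F)"
      by (rule bij_betw_same_card)
    then show ?thesis using insert.IH F True by (simp add: card_cartesian_product cyclomatic_insert)
  next
    case False
    \<comment> \<open>The cut around the component of one end makes q divide \<open>g e\<close>, and
      the range from 0 to q - 1 leaves only 0.\<close>
    have "g e = 0" if g: "g \<in> ?M (insert e F)" for g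
    proof -
      define S where "S = {w \<in> V. conn F (fst (ends e)) w}"
      have "(\<Sum>v\<in>S. net g v) = g e + (\<Sum>e'\<in>E - insert e F.
          (of_bool (fst (ends e') \<in> S) - of_bool (snd (ends e') \<in> S)) * g e')"
        unfolding S_def by (rule sum_net_bridge[OF F False])
      also have "(\<Sum>e'\<in>E - insert e F.
          (of_bool (fst (ends e') \<in> S) - of_bool (snd (ends e') \<in> S)) * g e') = 0"
        using g by (intro sum.neutral) auto
      finally have "g e = (\<Sum>v\<in>S. net g v)" by simp
      moreover have "int q dvd (\<Sum>v\<in>S. net g v)"
        using g by (intro dvd_sum) (auto simp: mod_flows_def S_def)
      moreover have "0 \<le> g e" "g e < int q" using g F by (auto simp: mod_flows_def PiE_iff)
      ultimately show ?thesis using zdvd_not_zless[of "g e" "int q"] by (cases "g e = 0") auto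
    qed
    then have "?M (insert e F) = ?M F" by auto
    then show ?thesis using insert.IH F False by (simp add: cyclomatic_insert)
  qed
qed

end

section \<open>Inclusion-exclusion\<close>

lemma of_bool_all_not_eq_sum:
  assumes "finite U"
  shows "(of_bool (\<forall>e\<in>U. \<not> P e) :: 'a::comm_ring_1) = (\<Sum>W\<in>Pow U. (-1) ^ card W * of_bool (\<forall>e\<in>W. P e))"
proof -
  have prod_of_bool: "(\<Prod>e\<in>W. of_bool (Q e)) = (of_bool (\<forall>e\<in>W. Q e) :: 'a)" if "finite W" for W Q
    using that by (induction W rule: finite_induct) auto
  have "(of_bool (\<forall>e\<in>U. \<not> P e) :: 'a) = (\<Prod>e\<in>U. of_bool (\<not> P e))"
    using assms by (simp add: prod_of_bool)
  \<comment> \<open>Expanding this product over subsets produces the alternating sum.\<close>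
  also have "\<dots> = (\<Prod>e\<in>U. 1 - of_bool (P e))"
    by (intro prod.cong) auto
  also have "\<dots> = (\<Sum>W\<in>Pow U. (-1) ^ card W * (\<Prod>e\<in>W. of_bool (P e)))"
    using assms by (subst prod_diff_conv_sum) auto
  also have "\<dots> = (\<Sum>W\<in>Pow U. (-1) ^ card W * of_bool (\<forall>e\<in>W. P e))"
    using assms by (intro sum.cong) (auto simp: prod_of_bool finite_subset)
  finally show ?thesis .
qed

lemma of_nat_card_filter:
  "finite A \<Longrightarrow> of_nat (card {a \<in> A. P a}) = (\<Sum>a\<in>A. of_bool (P a) :: 'a::comm_ring_1)"
  by (simp add: of_bool_def sum.If_cases Int_def)

text \<open>Used with \<open>P e\<close> saying that a flow vanishes at \<open>e\<close>, and again
  with \<open>P e\<close> saying that a lattice point lies on a facet.\<close>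

lemma card_all_not_eq_sum:
  assumes "finite A" "finite U"
  shows "(of_nat (card {a \<in> A. \<forall>e\<in>U. \<not> P e a}) :: 'a::comm_ring_1)
    = (\<Sum>W\<in>Pow U. (-1) ^ card W * of_nat (card {a \<in> A. \<forall>e\<in>W. P e a}))"
proof -
  have "(of_nat (card {a \<in> A. \<forall>e\<in>U. \<not> P e a}) :: 'a)
    = (\<Sum>a\<in>A. \<Sum>W\<in>Pow U. (-1) ^ card W * of_bool (\<forall>e\<in>W. P e a))"
    using assms by (simp add: of_nat_card_filter of_bool_all_not_eq_sum)
  also have "\<dots> = (\<Sum>W\<in>Pow U. \<Sum>a\<in>A. (-1) ^ card W * of_bool (\<forall>e\<in>W. P e a))"
    by (rule sum.swap)
  finally show ?thesis by (simp only: of_nat_card_filter[OF assms(1)] sum_distrib_left)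
qed

lemma sum_Pow_insert:
  assumes "finite Z" "e \<notin> Z"
  shows "(\<Sum>W\<in>Pow (insert e Z). f W) = (\<Sum>W\<in>Pow Z. f W + f (insert e W))"
proof -
  have "inj_on (insert e) (Pow Z)" using assms by (auto simp: inj_on_def)
  then have "(\<Sum>W\<in>insert e ` Pow Z. f W) = (\<Sum>W\<in>Pow Z. f (insert e W))"
    by (simp add: sum.reindex)
  moreover have "Pow Z \<inter> insert e ` Pow Z = {}" using assms by auto
  ultimately show ?thesis using assms by (simp add: Pow_insert sum.union_disjoint sum.distrib)
qed

section \<open>The flow polynomial\<close>

context multigraph
begin

text \<open>The inclusion-exclusion sum in which \<open>W\<close> is the set of edges forced to
  carry 0.\<close>

definition flow_poly :: "rat poly" where
  "flow_poly = (\<Sum>W\<in>Pow E. smult ((-1) ^ card W) (monom 1 (nullity (E - W))))"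

lemma poly_flow_poly:
  "poly flow_poly x = (\<Sum>W\<in>Pow E. (-1) ^ card W * x ^ nullity (E - W))"
  by (simp add: flow_poly_def poly_sum poly_monom)

lemma card_mod_flows_vanishing:
  assumes "q \<ge> 1" "W \<subseteq> E"
  shows "card {g \<in> mod_flows q. \<forall>e\<in>W. g e = 0} = q ^ nullity (E - W)"
  using card_mod_flows_supported[OF assms(1), of "E - W"] assms(2)
  by (simp add: double_diff)

lemma nzflow_count_eq_card: "q \<ge> 1 \<Longrightarrow> nzflow_count V E ends q = card {g \<in> mod_flows q. \<forall>e\<in>E. g e \<noteq> 0}"
  unfolding nzflow_count_def mod_flows_def net_def
  by (rule arg_cong[where f = card]) (fastforce simp: PiE_iff mod_eq_0_iff_dvd)

lemma poly_flow_poly_eq_nzflow_count: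
  assumes "q \<ge> 1"
  shows "poly flow_poly (of_nat q) = of_nat (nzflow_count V E ends q)"
proof -
  have "(of_nat (card {g \<in> mod_flows q. \<forall>e\<in>E. \<not> g e = 0}) :: rat)
     = (\<Sum>W\<in>Pow E. (-1) ^ card W * of_nat (card {g \<in> mod_flows q. \<forall>e\<in>W. g e = 0}))"
    by (rule card_all_not_eq_sum) auto
  also have "\<dots> = poly flow_poly (of_nat q)"
    unfolding poly_flow_poly by (intro sum.cong) (auto simp: card_mod_flows_vanishing[OF assms])
  finally show ?thesis by (simp add: nzflow_count_eq_card[OF assms])
qed

text \<open>Without bridges, only \<open>W = {}\<close> reaches the exponent
  \<open>nullity E\<close>, and its coefficient is 1.\<close>

lemma degree_flow_poly:
  assumes "bridgeless V E ends"
  shows "degree flow_poly = nullity E"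
proof (rule antisym)
  show "degree flow_poly \<le> nullity E"
    unfolding flow_poly_def
    by (intro degree_sum_le) (auto intro!: order_trans[OF degree_smult_le] order_trans[OF degree_monom_le] cyclomatic_mono)
  have "coeff flow_poly (nullity E) = (\<Sum>W\<in>Pow E. if W = {} then 1 else 0)"
    unfolding flow_poly_def coeff_sum
  proof (intro sum.cong refl)
    fix W assume W: "W \<in> Pow E"
    show "coeff (smult ((- 1) ^ card W) (monom 1 (nullity (E - W)))) (nullity E) = (if W = {} then 1 else (0::rat))"
    proof (cases "W = {}")
      case False
      then have "E - W \<subset> E" using W by auto
      with False show ?thesis using bridgeless_cyclomatic_less[OF assms, of "E - W"] by auto
    qed simp
  qed
  then have "coeff flow_poly (nullity E) = 1" by simp
  then show "nullity E \<le> degree flow_poly" by (intro le_degree) simp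
qed

subsection \<open>Relative totally cyclic orientations\<close>

text \<open>Edges of X are unconstrained, which plays the role of contracting them.\<close>

definition rel_cyclic :: "'e set \<Rightarrow> 'e set \<Rightarrow> 'e set \<Rightarrow> bool" where
  "rel_cyclic X Z \<sigma> \<longleftrightarrow> (\<exists>x :: 'e \<Rightarrow> int. (\<forall>e\<in>E - (X \<union> Z). x e = 0) \<and> (\<forall>v\<in>V. net x v = 0)
     \<and> (\<forall>e\<in>Z. 0 < dir_sign \<sigma> e * x e))"

lemma net_lincomb_eq_0:
  fixes x y :: "'e \<Rightarrow> int"
  assumes "\<forall>v\<in>V. net x v = 0" "\<forall>v\<in>V. net y v = 0"
  shows "\<forall>v\<in>V. net (\<lambda>e. a * x e + b * y e) v = 0"
  using assms by (simp add: net_add net_scale)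

text \<open>Consider the flows with prescribed signs on \<open>Z\<close> and any value at
  \<open>e\<close>. If both signs occur at \<open>e\<close>, a positive combination gives 0; if 0
  occurs, a perturbation along a cycle gives both signs. So the number of possible signs is one for
  the existence of a flow plus one for the existence of a flow vanishing at
  \<open>e\<close>.\<close>

lemma rel_cyclic_extensions:
  assumes XZ: "X \<subseteq> E" "Z \<subseteq> E" "e \<in> E" "e \<notin> X" "e \<notin> Z" and \<sigma>: "\<sigma> \<subseteq> Z"
    and conn: "conn (X \<union> Z) (fst (ends e)) (snd (ends e))"
  shows "of_bool (rel_cyclic X (insert e Z) \<sigma>) + of_bool (rel_cyclic X (insert e Z) (insert e \<sigma>))
    = (of_bool (rel_cyclic (insert e X) Z \<sigma>) + of_bool (rel_cyclic X Z \<sigma>) :: int)"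
proof -
  have e\<sigma>: "e \<notin> \<sigma>" using XZ \<sigma> by auto
  define Fl where "Fl x \<longleftrightarrow> (\<forall>e'\<in>E - insert e (X \<union> Z). x e' = 0) \<and> (\<forall>v\<in>V. net x v = 0)
    \<and> (\<forall>e\<in>Z. 0 < dir_sign \<sigma> e * x e)" for x :: "'e \<Rightarrow> int"
  have ds: "dir_sign (insert e \<sigma>) e' = dir_sign \<sigma> e'" if "e' \<in> Z" for e'
    using that XZ by (auto simp: dir_sign_def)
  have dse: "dir_sign (insert e \<sigma>) e = -1" "dir_sign \<sigma> e = 1" using e\<sigma> by (auto simp: dir_sign_def)
  have A: "rel_cyclic X (insert e Z) \<sigma> \<longleftrightarrow> (\<exists>x. Fl x \<and> x e > 0)"
    unfolding rel_cyclic_def Fl_def by (auto simp: dse)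
  have B: "rel_cyclic X (insert e Z) (insert e \<sigma>) \<longleftrightarrow> (\<exists>x. Fl x \<and> x e < 0)"
    unfolding rel_cyclic_def Fl_def by (auto simp: ds dse)
  have C: "rel_cyclic (insert e X) Z \<sigma> \<longleftrightarrow> (\<exists>x. Fl x)"
    unfolding rel_cyclic_def Fl_def by auto
  have D: "rel_cyclic X Z \<sigma> \<longleftrightarrow> (\<exists>x. Fl x \<and> x e = 0)"
  proof -
    have "(\<forall>e'\<in>E - (X \<union> Z). x e' = 0) \<longleftrightarrow> (\<forall>e'\<in>E - insert e (X \<union> Z). x e' = 0) \<and> x e = 0" for x :: "'e \<Rightarrow> int"
      using XZ by blast
    then show ?thesis unfolding rel_cyclic_def Fl_def by auto
  qed
  \<comment> \<open>The weights \<open>- y e\<close> and \<open>x e\<close> are positive and make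
    the values at \<open>e\<close> cancel.\<close>
  have AB: "\<exists>x. Fl x \<and> x e = 0" if "Fl x" "x e > 0" "Fl y" "y e < 0" for x y
  proof -
    let ?z = "\<lambda>e'. (- y e) * x e' + x e * y e'"
    have "0 < dir_sign \<sigma> e' * ?z e'" if "e' \<in> Z" for e'
    proof -
      have "0 < (- y e) * (dir_sign \<sigma> e' * x e')" "0 < x e * (dir_sign \<sigma> e' * y e')"
        using \<open>Fl x\<close> \<open>Fl y\<close> \<open>x e > 0\<close> \<open>y e < 0\<close> that unfolding Fl_def by (auto intro: mult_pos_pos mult_neg_pos)
      then have "0 < (- y e) * (dir_sign \<sigma> e' * x e') + x e * (dir_sign \<sigma> e' * y e')" by linarith
      then show ?thesis by (simp add: algebra_simps)
    qed
    then have "Fl ?z" using \<open>Fl x\<close> \<open>Fl y\<close> net_lincomb_eq_0[of x y "- y e" "x e"]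
      unfolding Fl_def by auto
    then show ?thesis by (intro exI[of _ ?z]) auto
  qed
  obtain y :: "'e \<Rightarrow> int" where y: "y e = 1" "\<And>e'. e' \<notin> insert e (X \<union> Z) \<Longrightarrow> y e' = 0" "\<And>v. net y v = 0"
    using cycle_through[of "X \<union> Z" e] XZ conn by auto
  \<comment> \<open>\<open>K\<close> exceeds every value of the cycle \<open>y\<close> on
    \<open>Z\<close>, so \<open>K * x\<close> dominates there and the signs on \<open>Z\<close>
    survive the perturbation.\<close>
  have DAB: "\<exists>x. Fl x \<and> x e = s" if "Fl x" "x e = 0" "\<bar>s\<bar> = 1" for x s
  proof -
    define K where "K = 1 + (\<Sum>e'\<in>Z. \<bar>y e'\<bar>)"
    let ?z = "\<lambda>e'. K * x e' + s * y e'"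
    have K: "\<bar>y e'\<bar> < K" if "e' \<in> Z" for e'
      using member_le_sum[OF that, of "\<lambda>e. \<bar>y e\<bar>"] finite_subset_E[OF XZ(2)] by (simp add: K_def)
    have "0 < dir_sign \<sigma> e' * ?z e'" if "e' \<in> Z" for e'
    proof -
      have "1 \<le> dir_sign \<sigma> e' * x e'" using \<open>Fl x\<close> that unfolding Fl_def by force
      then have "K * 1 \<le> K * (dir_sign \<sigma> e' * x e')"
        using K[OF that] by (intro mult_left_mono) auto
      moreover have "\<bar>dir_sign \<sigma> e' * (s * y e')\<bar> = \<bar>y e'\<bar>"
        using \<open>\<bar>s\<bar> = 1\<close> by (auto simp: abs_mult dir_sign_def)
      ultimately show ?thesis using K[OF that] by (simp add: algebra_simps)
    qed
    then have "Fl ?z" using \<open>Fl x\<close> y net_lincomb_eq_0[of x y K s]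
      unfolding Fl_def by auto
    then show ?thesis using \<open>x e = 0\<close> y(1) by (intro exI[of _ ?z]) auto
  qed
  have D1: "(\<exists>x. Fl x \<and> x e > 0)" "(\<exists>x. Fl x \<and> x e < 0)" if "\<exists>x. Fl x \<and> x e = 0"
    using that DAB[of _ 1] DAB[of _ "-1"] by fastforce+
  have C1: "(\<exists>x. Fl x) \<longleftrightarrow> (\<exists>x. Fl x \<and> x e > 0) \<or> (\<exists>x. Fl x \<and> x e < 0) \<or> (\<exists>x. Fl x \<and> x e = 0)"
  proof -
    have "x e > 0 \<or> x e < 0 \<or> x e = 0" for x :: "'e \<Rightarrow> int" by linarith
    then show ?thesis by blast
  qed
  have AB1: "\<exists>x. Fl x \<and> x e = 0" if "\<exists>x. Fl x \<and> x e > 0" "\<exists>x. Fl x \<and> x e < 0"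
    using that AB by blast
  have "of_bool a + of_bool b = (of_bool (a \<or> b \<or> d) + of_bool d :: int)"
    if "d \<Longrightarrow> a" "d \<Longrightarrow> b" "a \<Longrightarrow> b \<Longrightarrow> d" for a b d
    using that by (cases a; cases b; cases d) auto
  from this[OF D1 AB1] show ?thesis unfolding A B C D C1 .
qed

text \<open>Conservation across the cut defined by the bridge forces the value 0 on it, which
  contradicts strict positivity.\<close>

lemma not_rel_cyclic_bridge:
  assumes XZ: "X \<subseteq> E" "Z \<subseteq> E" "e \<in> E" "e \<notin> X" "e \<notin> Z"
    and nc: "\<not> conn (X \<union> Z) (fst (ends e)) (snd (ends e))"
  shows "\<not> rel_cyclic X (insert e Z) \<sigma>"
proof
  assume "rel_cyclic X (insert e Z) \<sigma>"
  then obtain x :: "'e \<Rightarrow> int" where x: "\<forall>e'\<in>E - (X \<union> insert e Z). x e' = 0" "\<forall>v\<in>V. net x v = 0"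
    "0 < dir_sign \<sigma> e * x e" unfolding rel_cyclic_def by auto
  define S where "S = {w \<in> V. conn (X \<union> Z) (fst (ends e)) w}"
  have "(\<Sum>v\<in>S. net x v) = x e + (\<Sum>e'\<in>E - insert e (X \<union> Z).
      (of_bool (fst (ends e') \<in> S) - of_bool (snd (ends e') \<in> S)) * x e')"
    unfolding S_def by (rule sum_net_bridge) (use XZ nc in auto)
  also have "(\<Sum>e'\<in>E - insert e (X \<union> Z).
      (of_bool (fst (ends e') \<in> S) - of_bool (snd (ends e') \<in> S)) * x e') = 0"
    using x by (intro sum.neutral) auto
  also have "(\<Sum>v\<in>S. net x v) = 0" using x by (intro sum.neutral) (auto simp: S_def)
  finally show False using x by simp
qed

text \<open>Deletion-contraction on \<open>Z\<close>. The induction keeps \<open>X\<close> arbitrary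
  because contracting \<open>e\<close> moves it into \<open>X\<close>.\<close>

lemma card_rel_cyclic:
  assumes "X \<subseteq> E" "Z \<subseteq> E" "X \<inter> Z = {}"
  shows "int (card {\<sigma> \<in> Pow Z. rel_cyclic X Z \<sigma>})
    = (\<Sum>W\<in>Pow Z. (-1) ^ (card W + nullity (X \<union> Z) + nullity (X \<union> Z - W)))"
  using finite_subset_E[OF assms(2)] assms
proof (induction Z arbitrary: X rule: finite_induct)
  case empty
  have "rel_cyclic X {} {}"
    unfolding rel_cyclic_def by (intro exI[of _ "\<lambda>_. 0"]) auto
  then have "{\<sigma> \<in> Pow {}. rel_cyclic X {} \<sigma>} = {{}}" by auto
  then show ?case by (simp add: power_add[symmetric] flip: mult_2)
next
  case (insert e Z)
  then have XZ: "X \<subseteq> E" "Z \<subseteq> E" "e \<in> E" "e \<notin> X" "e \<notin> Z" by auto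
  let ?f = "\<lambda>X Z W. (-1 :: int) ^ (card W + nullity (X \<union> Z) + nullity (X \<union> Z - W))"
  have "int (card {\<sigma> \<in> Pow (insert e Z). rel_cyclic X (insert e Z) \<sigma>})
    = (\<Sum>\<sigma>\<in>Pow (insert e Z). of_bool (rel_cyclic X (insert e Z) \<sigma>))"
    using insert.hyps by (subst of_nat_card_filter[where 'a = int, simplified]) auto
  also have "\<dots> = (\<Sum>\<sigma>\<in>Pow Z. of_bool (rel_cyclic X (insert e Z) \<sigma>)
      + of_bool (rel_cyclic X (insert e Z) (insert e \<sigma>)))"
    by (rule sum_Pow_insert[OF insert.hyps])
  also have "\<dots> = (\<Sum>W\<in>Pow Z. ?f X (insert e Z) W + ?f X (insert e Z) (insert e W))"
  proof (cases "conn (X \<union> Z) (fst (ends e)) (snd (ends e))")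
    case True
    have "(\<Sum>\<sigma>\<in>Pow Z. of_bool (rel_cyclic X (insert e Z) \<sigma>)
        + of_bool (rel_cyclic X (insert e Z) (insert e \<sigma>)))
      = (\<Sum>\<sigma>\<in>Pow Z. of_bool (rel_cyclic (insert e X) Z \<sigma>) + of_bool (rel_cyclic X Z \<sigma>) :: int)"
      by (intro sum.cong refl rel_cyclic_extensions XZ True) auto
    also have "\<dots> = int (card {\<sigma> \<in> Pow Z. rel_cyclic (insert e X) Z \<sigma>}) + int (card {\<sigma> \<in> Pow Z. rel_cyclic X Z \<sigma>})"
      using insert.hyps by (simp only: of_nat_card_filter[of "Pow Z", where 'a = int] finite_Pow_iff sum.distrib)
    also have "\<dots> = (\<Sum>W\<in>Pow Z. ?f (insert e X) Z W) + (\<Sum>W\<in>Pow Z. ?f X Z W)"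
      using insert.IH[of "insert e X"] insert.IH[of X] insert.prems insert.hyps by simp
    \<comment> \<open>Sets \<open>W\<close> missing \<open>e\<close> match the count with
      \<open>e\<close> unconstrained, sets containing \<open>e\<close> the count with
      \<open>e\<close> deleted; there the extra 1 in \<open>card W\<close> is offset by the extra 1
      in the nullity of the whole set.\<close>
    also have "\<dots> = (\<Sum>W\<in>Pow Z. ?f X (insert e Z) W + ?f X (insert e Z) (insert e W))"
      unfolding sum.distrib[symmetric]
    proof (intro sum.cong refl arg_cong2[where f = "(+)"])
      fix W assume W: "W \<in> Pow Z"
      show "?f (insert e X) Z W = ?f X (insert e Z) W" by simp
      have "nullity (X \<union> insert e Z) = Suc (nullity (X \<union> Z))"
        using cyclomatic_insert[of e "X \<union> Z"] XZ True by simp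
      moreover have "X \<union> insert e Z - insert e W = X \<union> Z - W" using XZ by auto
      moreover have "card (insert e W) = Suc (card W)"
        using W XZ insert.hyps by (subst card_insert_disjoint) (auto intro: finite_subset)
      ultimately show "?f X Z W = ?f X (insert e Z) (insert e W)" by simp
    qed
    finally show ?thesis .
  next
    case False
    \<comment> \<open>Putting a bridge into \<open>W\<close> leaves the nullity alone but changes
      the parity of \<open>card W\<close>, so the terms cancel in pairs, in accordance with the
      absence of orientations.\<close>
    have "?f X (insert e Z) W + ?f X (insert e Z) (insert e W) = 0" if W: "W \<in> Pow Z" for W
    proof -
      have sub: "X \<union> Z - W \<subseteq> E" "e \<notin> X \<union> Z - W" using XZ by auto
      have "\<not> conn (X \<union> Z - W) (fst (ends e)) (snd (ends e))"
        using False connected_mono[OF Diff_subset, of "X \<union> Z" W ends "fst (ends e)" "snd (ends e)"] by argo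
      then have "nullity (insert e (X \<union> Z - W)) = nullity (X \<union> Z - W)"
        using cyclomatic_insert[OF XZ(3) sub] by simp
      moreover have "X \<union> insert e Z - W = insert e (X \<union> Z - W)" using XZ W by auto
      moreover have "X \<union> insert e Z - insert e W = X \<union> Z - W" using XZ by auto
      moreover have "card (insert e W) = Suc (card W)"
        using W XZ insert.hyps by (subst card_insert_disjoint) (auto intro: finite_subset)
      ultimately show ?thesis by simp
    qed
    then show ?thesis using not_rel_cyclic_bridge[OF XZ False] by simp
  qed
  also have "\<dots> = (\<Sum>W\<in>Pow (insert e Z). ?f X (insert e Z) W)"
    by (rule sum_Pow_insert[OF insert.hyps, symmetric])
  finally show ?case .
qed


subsection \<open>Totally cyclic orientations and Eulerian equivalence\<close>

lemma sum_net_oriented: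
  assumes "finite S"
  shows "(\<Sum>v\<in>S. net (\<lambda>e. dir_sign R e * y e) v)
    = (\<Sum>e\<in>E. (of_bool (tail ends R e \<in> S) - of_bool (head ends R e \<in> S)) * y e)"
  unfolding sum_net[OF assms] by (intro sum.cong) (auto simp: dir_sign_def tail_def head_def)

text \<open>The walk respects the orientation, so its unit flow is nonnegative once measured along
  \<open>R\<close>.\<close>

lemma directed_path_exists:
  assumes "(\<lambda>u w. \<exists>e\<in>E. tail ends R e = u \<and> head ends R e = w)\<^sup>*\<^sup>* u w"
  shows "\<exists>p :: 'e \<Rightarrow> int. (\<forall>e. p e \<ge> 0) \<and>
    (\<forall>v. net (\<lambda>e. dir_sign R e * p e) v = of_bool (v = u) - of_bool (v = w))"
  using assms
proof (induction rule: rtranclp_induct)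
  case base
  show ?case by (intro exI[of _ "\<lambda>_. 0"]) auto
next
  case (step y z)
  then obtain p :: "'e \<Rightarrow> int" where p: "\<forall>e. p e \<ge> 0"
    "\<And>v. net (\<lambda>e. dir_sign R e * p e) v = of_bool (v = u) - of_bool (v = y)" by auto
  from step.hyps(2) obtain e where e: "e \<in> E" "tail ends R e = y" "head ends R e = z" by auto
  define p' where "p' e' = p e' + of_bool (e' = e)" for e'
  have "net (\<lambda>e. dir_sign R e * p' e) v = of_bool (v = u) - of_bool (v = z)" for v
  proof -
    have "net (\<lambda>e. dir_sign R e * p' e) v
        = net (\<lambda>e'. dir_sign R e' * p e' + of_bool (e' = e) * dir_sign R e) v"
      by (intro net_cong) (auto simp: p'_def algebra_simps)
    also have "\<dots> = of_bool (v = u) - of_bool (v = y) + inc ends R v e"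
      unfolding net_add p(2) net_single[OF e(1)] by (simp add: inc_dir_sign[of ends R])
    finally show ?thesis using e by (simp add: inc_eq)
  qed
  moreover have "\<forall>e. p' e \<ge> 0" using p by (auto simp: p'_def)
  ultimately show ?case by blast
qed

text \<open>Let \<open>S\<close> be the set of vertices reachable from the head of \<open>e\<close>.
  No arc leaves \<open>S\<close>; if the tail of \<open>e\<close> were outside, \<open>e\<close>
  would enter \<open>S\<close> and the cut would be directed. So a directed path closes
  \<open>e\<close> to a cycle.\<close>

lemma totally_cyclic_flow_through:
  assumes "totally_cyclic V E ends R" "e \<in> E"
  shows "\<exists>y :: 'e \<Rightarrow> int. y e \<ge> 1 \<and> (\<forall>e. y e \<ge> 0) \<and> (\<forall>v. net (\<lambda>e. dir_sign R e * y e) v = 0)"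
proof -
  let ?r = "(\<lambda>u w. \<exists>e\<in>E. tail ends R e = u \<and> head ends R e = w)"
  define S where "S = {w \<in> V. ?r\<^sup>*\<^sup>* (head ends R e) w}"
  have V: "tail ends R e' \<in> V" "head ends R e' \<in> V" if "e' \<in> E" for e'
    using that by (auto simp: tail_def head_def)
  have "tail ends R e \<in> S"
  proof (rule ccontr)
    assume t: "tail ends R e \<notin> S"
    have h: "head ends R e \<in> S" using assms(2) V by (auto simp: S_def)
    have closed: "head ends R e' \<in> S" if "tail ends R e' \<in> S" "e' \<in> E" for e'
      using that V[OF that(2)] unfolding S_def by (auto intro: rtranclp.rtrancl_into_rtrancl)
    have cut_iff: "e' \<in> cut V E ends S \<longleftrightarrow> e' \<in> E \<and> (tail ends R e' \<in> S \<longleftrightarrow> head ends R e' \<notin> S)" for e'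
      using ends_in_V[of e'] unfolding cut_def tail_def head_def by auto
    have "e \<in> cut V E ends S" unfolding cut_iff using t h assms(2) by auto
    moreover have "\<forall>e'\<in>cut V E ends S. tail ends R e' \<in> V - S"
      using closed V by (auto simp: cut_iff)
    moreover have "{} \<subset> S" "S \<subset> V" using t h V[OF assms(2)] by (auto simp: S_def)
    ultimately have "directed_cut V E ends R S"
      unfolding directed_cut_def by (intro conjI disjI2) auto
    then show False using assms(1) by (auto simp: totally_cyclic_def)
  qed
  then have "?r\<^sup>*\<^sup>* (head ends R e) (tail ends R e)" by (simp add: S_def)
  from directed_path_exists[OF this] obtain p :: "'e \<Rightarrow> int" where p: "\<forall>e. p e \<ge> 0"
    "\<And>v. net (\<lambda>e. dir_sign R e * p e) v = of_bool (v = head ends R e) - of_bool (v = tail ends R e)" by auto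
  define y where "y e' = p e' + of_bool (e' = e)" for e'
  have "net (\<lambda>e. dir_sign R e * y e) v = 0" for v
  proof -
    have "net (\<lambda>e. dir_sign R e * y e) v
        = net (\<lambda>e'. dir_sign R e' * p e' + of_bool (e' = e) * dir_sign R e) v"
      by (intro net_cong) (auto simp: y_def algebra_simps)
    also have "\<dots> = 0"
      unfolding net_add p(2) net_single[OF assms(2)]
      by (simp add: inc_dir_sign[of ends R, symmetric]) (simp add: inc_eq)
    finally show ?thesis .
  qed
  moreover have "y e \<ge> 1" "\<forall>e. y e \<ge> 0" using p by (auto simp: y_def)
  ultimately show ?thesis by blast
qed

text \<open>Summing the nonnegative flows through the single edges gives one that is positive
  everywhere; conversely, a positive flow cannot cross a cut in one direction only.\<close>

lemma totally_cyclic_iff: "totally_cyclic V E ends R \<longleftrightarrow> R \<subseteq> E \<and> rel_cyclic {} E R"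
proof
  assume tc: "totally_cyclic V E ends R"
  then have "\<forall>e\<in>E. \<exists>y :: 'e \<Rightarrow> int. y e \<ge> 1 \<and> (\<forall>e. y e \<ge> 0) \<and> (\<forall>v. net (\<lambda>e. dir_sign R e * y e) v = 0)"
    using totally_cyclic_flow_through by blast
  then obtain y :: "'e \<Rightarrow> 'e \<Rightarrow> int" where y: "\<And>e. e \<in> E \<Longrightarrow> y e e \<ge> 1" "\<And>e e'. e \<in> E \<Longrightarrow> y e e' \<ge> 0"
    "\<And>e v. e \<in> E \<Longrightarrow> net (\<lambda>e'. dir_sign R e' * y e e') v = 0"
    by metis
  define x where "x e' = (\<Sum>e\<in>E. dir_sign R e' * y e e')" for e'
  have "net x v = 0" for v
    unfolding x_def[abs_def] by (subst net_sum) (auto simp: y)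
  moreover have "0 < dir_sign R e * x e" if "e \<in> E" for e
  proof -
    have "dir_sign R e * x e = (\<Sum>e'\<in>E. y e' e)" by (simp add: x_def sum_distrib_left)
    also have "\<dots> \<ge> y e e" by (rule member_le_sum) (use that y in auto)
    finally show ?thesis using y(1)[OF that] by linarith
  qed
  ultimately have "rel_cyclic {} E R" unfolding rel_cyclic_def by auto
  then show "R \<subseteq> E \<and> rel_cyclic {} E R" using tc by (auto simp: totally_cyclic_def orientations_def)
next
  assume "R \<subseteq> E \<and> rel_cyclic {} E R"
  then obtain x :: "'e \<Rightarrow> int" where R: "R \<subseteq> E" and x: "\<And>v. v \<in> V \<Longrightarrow> net x v = 0" "\<And>e. e \<in> E \<Longrightarrow> 0 < dir_sign R e * x e"
    unfolding rel_cyclic_def by auto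
  define y where "y e = dir_sign R e * x e" for e
  have "\<not> directed_cut V E ends R S" for S
  proof
    assume dc: "directed_cut V E ends R S"
    then have S: "S \<subseteq> V" by (auto simp: directed_cut_def)
    have cut_iff: "e' \<in> cut V E ends S \<longleftrightarrow> e' \<in> E \<and> (tail ends R e' \<in> S \<longleftrightarrow> head ends R e' \<notin> S)" for e'
      using ends_in_V[of e'] unfolding cut_def tail_def head_def by auto
    let ?C = "cut V E ends S"
    have "0 = (\<Sum>v\<in>S. net (\<lambda>e. dir_sign R e * y e) v)"
      using S x by (intro sum.neutral[symmetric]) (auto simp: y_def)
    also have "\<dots> = (\<Sum>e\<in>E. (of_bool (tail ends R e \<in> S) - of_bool (head ends R e \<in> S)) * y e)"
      by (rule sum_net_oriented) (use S in \<open>auto intro: finite_subset\<close>)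
    also have "\<dots> = (\<Sum>e\<in>?C. (of_bool (tail ends R e \<in> S) - of_bool (head ends R e \<in> S)) * y e)"
      by (intro sum.mono_neutral_right) (auto simp: cut_iff)
    finally have 0: "(\<Sum>e\<in>?C. (of_bool (tail ends R e \<in> S) - of_bool (head ends R e \<in> S)) * y e) = 0" by simp
    \<comment> \<open>On a directed cut all coefficients in the vanishing sum have the same sign, so
      the plain sum of the positive values would vanish too.\<close>
    have "(\<Sum>e\<in>?C. y e) > 0"
      using dc x by (intro sum_pos) (auto simp: directed_cut_def y_def cut_iff intro: finite_subset[of _ E])
    moreover have "(\<Sum>e\<in>?C. y e) = 0"
    proof -
      have "(\<forall>e\<in>?C. tail ends R e \<in> S) \<or> (\<forall>e\<in>?C. tail ends R e \<in> V - S)"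
        using dc by (simp only: directed_cut_def)
      then show ?thesis
      proof
        assume 1: "\<forall>e\<in>?C. tail ends R e \<in> S"
        have "(\<Sum>e\<in>?C. y e) = (\<Sum>e\<in>?C. (of_bool (tail ends R e \<in> S) - of_bool (head ends R e \<in> S)) * y e)"
        proof (intro sum.cong refl)
          fix e assume e: "e \<in> ?C"
          have "tail ends R e \<in> S" "head ends R e \<notin> S" using bspec[OF 1 e] e[unfolded cut_iff] by simp_all
          then show "y e = (of_bool (tail ends R e \<in> S) - of_bool (head ends R e \<in> S)) * y e" by simp
        qed
        then show ?thesis using 0 by simp
      next
        assume 2: "\<forall>e\<in>?C. tail ends R e \<in> V - S"
        have "- (\<Sum>e\<in>?C. y e) = (\<Sum>e\<in>?C. (of_bool (tail ends R e \<in> S) - of_bool (head ends R e \<in> S)) * y e)"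
          unfolding sum_negf[symmetric]
        proof (intro sum.cong refl)
          fix e assume e: "e \<in> ?C"
          have "tail ends R e \<notin> S" "head ends R e \<in> S" using bspec[OF 2 e] e[unfolded cut_iff] by simp_all
          then show "- y e = (of_bool (tail ends R e \<in> S) - of_bool (head ends R e \<in> S)) * y e" by simp
        qed
        then show ?thesis using 0 by simp
      qed
    qed
    ultimately show False by simp
  qed
  then show "totally_cyclic V E ends R" using R by (auto simp: totally_cyclic_def orientations_def)
qed

text \<open>Reversing the edges of \<open>D\<close> changes out-degree minus in-degree by twice the
  imbalance of \<open>D\<close>. An Eulerian class is therefore determined by the imbalance
  \<open>net (dir_sign R)\<close> on \<open>V\<close>.\<close>

lemma eul_equiv_iff:
  "eul_equiv V E ends R1 R2 \<longleftrightarrow> R1 \<subseteq> E \<and> R2 \<subseteq> E \<and> (\<forall>v\<in>V. net (dir_sign R1) v = net (dir_sign R2) v)"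
proof -
  define D where "D = (R1 - R2) \<union> (R2 - R1)"
  have "card {e \<in> D. tail ends R1 e = v} = card {e \<in> D. head ends R1 e = v}
      \<longleftrightarrow> net (dir_sign R1) v = net (dir_sign R2) v" if "R1 \<subseteq> E" "R2 \<subseteq> E" for v
  proof -
    have D: "D \<subseteq> E" using that by (auto simp: D_def)
    have fin: "finite D" by (rule finite_subset_E[OF D])
    have "2 * (int (card {e \<in> D. tail ends R1 e = v}) - int (card {e \<in> D. head ends R1 e = v}))
      = 2 * (\<Sum>e\<in>D. of_bool (tail ends R1 e = v) - of_bool (head ends R1 e = v))"
      by (simp only: of_nat_card_filter[OF fin, where 'a = int] sum_subtractf)
    also have "\<dots> = (\<Sum>e\<in>D. 2 * inc ends R1 v e)"
      unfolding sum_distrib_left by (intro sum.cong) (auto simp: inc_eq)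
    also have "\<dots> = (\<Sum>e\<in>D. inc ends {} v e * (dir_sign R1 e - dir_sign R2 e))"
      by (intro sum.cong) (auto simp: inc_dir_sign[of ends R1] dir_sign_def D_def)
    also have "\<dots> = net (\<lambda>e. dir_sign R1 e - dir_sign R2 e) v"
      unfolding net_def using D by (intro sum.mono_neutral_cong_left) (auto simp: dir_sign_def D_def)
    also have "\<dots> = net (dir_sign R1) v - net (dir_sign R2) v" by (simp add: net_diff)
    finally show ?thesis by auto
  qed
  then show ?thesis by (auto simp: eul_equiv_def directed_eulerian_def orientations_def D_def)
qed

text \<open>Carries a flow for \<open>R1\<close> with values in [0,q] over to an equivalent
  orientation \<open>R2\<close>: reversing an edge replaces its value by the complement to
  q.\<close>

definition flip :: "int \<Rightarrow> 'e set \<Rightarrow> 'e set \<Rightarrow> ('e \<Rightarrow> int) \<Rightarrow> 'e \<Rightarrow> int" where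
  "flip q R1 R2 f e = (if e \<in> R1 \<longleftrightarrow> e \<in> R2 then f e else q - f e)"

text \<open>Where the orientations differ, so do their signs by 2; doubling avoids a
  division.\<close>

lemma two_net_flip:
  "2 * net (\<lambda>e. dir_sign R2 e * flip q R1 R2 f e) v
     = 2 * net (\<lambda>e. dir_sign R1 e * f e) v - q * (net (dir_sign R1) v - net (dir_sign R2) v)"
proof -
  have "2 * net (\<lambda>e. dir_sign R2 e * flip q R1 R2 f e) v
    = net (\<lambda>e. 2 * (dir_sign R1 e * f e) - q * (dir_sign R1 e - dir_sign R2 e)) v"
    unfolding net_scale[symmetric]
    by (intro net_cong) (auto simp: flip_def dir_sign_def algebra_simps)
  then show ?thesis by (simp only: net_diff net_scale)
qed

subsection \<open>Integer flows and flows modulo q\<close>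

text \<open>The lattice points in the q-fold dilate of the flow polytope of
  \<open>R\<close>.\<close>

definition box_flows :: "'e set \<Rightarrow> nat \<Rightarrow> ('e \<Rightarrow> int) set" where
  "box_flows R q = {f \<in> E \<rightarrow>\<^sub>E {0..int q}. int_flow V E ends R f}"

lemma finite_box_flows [simp]: "finite (box_flows R q)"
  by (rule finite_subset[of _ "E \<rightarrow>\<^sub>E {0..int q}"]) (auto simp: box_flows_def intro!: finite_PiE)

lemma box_flowsD:
  assumes "f \<in> box_flows R q"
  shows "\<And>e. e \<in> E \<Longrightarrow> 0 \<le> f e \<and> f e \<le> int q" "\<And>e. e \<notin> E \<Longrightarrow> f e = undefined"
    "\<And>v. v \<in> V \<Longrightarrow> net (\<lambda>e. dir_sign R e * f e) v = 0"
  using assms by (auto simp: box_flows_def int_flow_iff PiE_iff extensional_def)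

text \<open>The residue of \<open>dir_sign R e * f e\<close> modulo q. The values 0 and q become
  indistinguishable here; \<open>zero_dirs\<close> retains that difference.\<close>

definition reduce :: "nat \<Rightarrow> 'e set \<Rightarrow> ('e \<Rightarrow> int) \<Rightarrow> 'e \<Rightarrow> int" where
  "reduce q R f = (\<lambda>e\<in>E. if f e = 0 \<or> f e = int q then 0 else if e \<in> R then int q - f e else f e)"

text \<open>The value q on an edge is read as the value 0 on the reversed edge.\<close>

definition zero_dirs :: "nat \<Rightarrow> 'e set \<Rightarrow> ('e \<Rightarrow> int) \<Rightarrow> 'e set" where
  "zero_dirs q R f = {e \<in> E. (f e = 0 \<and> e \<in> R) \<or> (f e = int q \<and> e \<notin> R)}"

definition cyclic_mod_flows :: "nat \<Rightarrow> (('e \<Rightarrow> int) \<times> 'e set) set" where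
  "cyclic_mod_flows q = (SIGMA g:mod_flows q.
     {\<sigma> \<in> Pow {e\<in>E. g e = 0}. rel_cyclic {e\<in>E. g e \<noteq> 0} {e\<in>E. g e = 0} \<sigma>})"

lemma reduce_in_cyclic_mod_flows:
  assumes q: "q \<ge> 1" and tc: "totally_cyclic V E ends R" and f: "f \<in> box_flows R q"
  shows "(reduce q R f, zero_dirs q R f) \<in> cyclic_mod_flows q"
proof -
  note f' = box_flowsD[OF f]
  have "int q dvd net (reduce q R f) v" if "v \<in> V" for v
  proof -
    have "int q dvd reduce q R f e - dir_sign R e * f e" if "e \<in> E" for e
      using that by (auto simp: reduce_def dir_sign_def)
    from net_mod_dvd_iff[of "int q" "reduce q R f" "\<lambda>e. dir_sign R e * f e", OF this] f'(3)[OF that]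
    show ?thesis by simp
  qed
  moreover have "reduce q R f \<in> E \<rightarrow>\<^sub>E {0..int q - 1}"
    using f'(1) q by (fastforce simp: reduce_def PiE_iff)
  ultimately have g: "reduce q R f \<in> mod_flows q" by (simp add: mod_flows_def)
  have z: "reduce q R f e = 0 \<longleftrightarrow> f e = 0 \<or> f e = int q" if "e \<in> E" for e
    using that by (auto simp: reduce_def)
  obtain x :: "'e \<Rightarrow> int" where x: "\<And>v. v \<in> V \<Longrightarrow> net x v = 0" "\<And>e. e \<in> E \<Longrightarrow> 0 < dir_sign R e * x e"
    using tc unfolding totally_cyclic_iff rel_cyclic_def by auto
  define K where "K = 1 + (\<Sum>e\<in>E. \<bar>x e\<bar>)"
  have K: "\<bar>x e\<bar> < K" if "e \<in> E" for e
    using member_le_sum[OF that, of "\<lambda>e. \<bar>x e\<bar>"] by (simp add: K_def)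
  \<comment> \<open>Subtracting a large multiple of the flow makes the flow negative exactly where it equals q.\<close>
  define x' where "x' e = x e - K * (dir_sign R e * f e)" for e
  have "net x' v = 0" if "v \<in> V" for v
    unfolding x'_def net_diff net_scale using f'(3)[OF that] x(1)[OF that] by simp
  moreover have "0 < dir_sign (zero_dirs q R f) e * x' e" if "e \<in> E" "f e = 0 \<or> f e = int q" for e
  proof (cases "f e = 0")
    case True
    then show ?thesis using x(2)[OF that(1)] that q by (simp add: x'_def zero_dirs_def dir_sign_def)
  next
    case False
    then have fe: "f e = int q" using that by auto
    have "dir_sign (zero_dirs q R f) e = - dir_sign R e"
      using fe q that by (auto simp: zero_dirs_def dir_sign_def)
    then have "dir_sign (zero_dirs q R f) e * x' e = K * int q - dir_sign R e * x e"
      by (simp add: x'_def fe algebra_simps)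
    moreover have "K * 1 \<le> K * int q" using K[OF that(1)] q by (intro mult_left_mono) auto
    moreover have "dir_sign R e * x e \<le> \<bar>x e\<bar>" by (auto simp: dir_sign_def)
    ultimately show ?thesis using K[OF that(1)] by linarith
  qed
  ultimately have "rel_cyclic {e\<in>E. reduce q R f e \<noteq> 0} {e\<in>E. reduce q R f e = 0} (zero_dirs q R f)"
    unfolding rel_cyclic_def using z by (intro exI[of _ x']) auto
  moreover have "zero_dirs q R f \<subseteq> {e\<in>E. reduce q R f e = 0}"
    using z by (auto simp: zero_dirs_def)
  ultimately show ?thesis using g by (auto simp: cyclic_mod_flows_def)
qed

text \<open>Rounding \<open>g / q\<close> to a vector \<open>h\<close> of zeros and ones with the
  same boundary makes \<open>g - q * h\<close> an integer flow with values between -q and q. Its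
  signs orient the support of \<open>g\<close>, and \<open>\<sigma>\<close> orients the
  zeros.\<close>

lemma lift_mod_flow:
  assumes q: "q \<ge> 1" and g: "(g, \<sigma>) \<in> cyclic_mod_flows q"
  shows "\<exists>R f. totally_cyclic V E ends R \<and> f \<in> box_flows R q \<and> reduce q R f = g \<and> zero_dirs q R f = \<sigma>"
proof -
  have g': "\<And>e. e \<in> E \<Longrightarrow> 0 \<le> g e \<and> g e < int q" "\<And>e. e \<notin> E \<Longrightarrow> g e = undefined"
    "\<And>v. v \<in> V \<Longrightarrow> int q dvd net g v"
    using g by (auto simp: cyclic_mod_flows_def mod_flows_def PiE_iff extensional_def)
  have \<sigma>: "\<sigma> \<subseteq> {e\<in>E. g e = 0}" using g by (auto simp: cyclic_mod_flows_def)
  have "rel_cyclic {e\<in>E. g e \<noteq> 0} {e\<in>E. g e = 0} \<sigma>" using g by (auto simp: cyclic_mod_flows_def)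
  then obtain x :: "'e \<Rightarrow> int" where "\<forall>v\<in>V. net x v = 0" "\<forall>e\<in>{e\<in>E. g e = 0}. 0 < dir_sign \<sigma> e * x e"
    unfolding rel_cyclic_def by (elim exE conjE)
  then have x: "\<And>v. v \<in> V \<Longrightarrow> net x v = 0" "\<And>e. e \<in> E \<Longrightarrow> g e = 0 \<Longrightarrow> 0 < dir_sign \<sigma> e * x e"
    by simp_all
  have "int q > 0" using q by simp
  then have "\<exists>z :: 'e \<Rightarrow> int. (\<forall>e\<in>E. \<lfloor>of_int (g e) / of_int (int q) :: rat\<rfloor> \<le> z e \<and> z e \<le> \<lceil>of_int (g e) / of_int (int q) :: rat\<rceil>)
      \<and> (\<forall>v\<in>V. int q * net z v = net g v)"
    by (rule integral_rounding_scaled) (rule g'(3))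
  then obtain h :: "'e \<Rightarrow> int" where
    h0: "\<forall>e\<in>E. \<lfloor>of_int (g e) / of_int (int q) :: rat\<rfloor> \<le> h e \<and> h e \<le> \<lceil>of_int (g e) / of_int (int q) :: rat\<rceil>"
    and h1: "\<forall>v\<in>V. int q * net h v = net g v"
    by (elim exE conjE)
  have h: "h e = 0 \<or> (h e = 1 \<and> g e \<noteq> 0)" if "e \<in> E" for e
  proof -
    have "0 \<le> \<lfloor>of_int (g e) / of_int (int q) :: rat\<rfloor>" using g'(1)[OF that] by simp
    moreover have "\<lceil>of_int (g e) / of_int (int q) :: rat\<rceil> \<le> 1"
      using g'(1)[OF that] q by (simp add: ceiling_le_iff field_simps)
    ultimately have "0 \<le> h e" "h e \<le> 1" using bspec[OF h0 that] by linarith+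
    moreover have "h e \<le> 0" if "g e = 0" using bspec[OF h0 \<open>e \<in> E\<close>] that by simp
    ultimately show ?thesis by (cases "g e = 0") auto
  qed
  define R where "R = {e\<in>E. h e = 1} \<union> \<sigma>"
  define f where "f = (\<lambda>e\<in>E. if h e = 1 then int q - g e else g e)"
  have sf: "dir_sign R e * f e = g e - int q * h e" if "e \<in> E" for e
    using that h[OF that] \<sigma> by (auto simp: R_def f_def dir_sign_def)
  have nf: "net (\<lambda>e. dir_sign R e * f e) v = 0" if "v \<in> V" for v
  proof -
    have "net (\<lambda>e. dir_sign R e * f e) v = net (\<lambda>e. g e - int q * h e) v"
      by (rule net_cong) (rule sf)
    then show ?thesis using bspec[OF h1 that] by (simp add: net_diff net_scale)
  qed
  have "f e \<in> {0..int q}" if "e \<in> E" for e using that g'(1)[OF that] by (auto simp: f_def)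
  then have "f \<in> box_flows R q"
    using nf by (auto simp: box_flows_def int_flow_iff PiE_iff f_def)
  moreover have "reduce q R f = g"
  proof
    fix e
    show "reduce q R f e = g e"
      using g'(1)[of e] g'(2)[of e] h[of e] \<sigma> by (cases "e \<in> E") (auto simp: reduce_def f_def R_def)
  qed
  moreover have "zero_dirs q R f = \<sigma>"
  proof (intro set_eqI)
    fix e
    show "e \<in> zero_dirs q R f \<longleftrightarrow> e \<in> \<sigma>"
      using g'(1)[of e] h[of e] \<sigma> q by (cases "e \<in> E") (auto simp: zero_dirs_def f_def R_def)
  qed
  moreover have "totally_cyclic V E ends R"
  proof -
    define K where "K = 1 + (\<Sum>e\<in>E. \<bar>x e\<bar>)"
    have K: "\<bar>x e\<bar> < K" if "e \<in> E" for e
      using member_le_sum[OF that, of "\<lambda>e. \<bar>x e\<bar>"] by (simp add: K_def)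
    \<comment> \<open>Where \<open>f\<close> is positive the large multiple decides the sign; on the
      zeros of \<open>g\<close> the flow \<open>x\<close> supplied by \<open>rel_cyclic\<close>
      does.\<close>
    define x' where "x' e = x e + K * (dir_sign R e * f e)" for e
    have "net x' v = 0" if "v \<in> V" for v
      unfolding x'_def net_add net_scale using nf[OF that] x(1)[OF that] by simp
    moreover have "0 < dir_sign R e * x' e" if "e \<in> E" for e
    proof (cases "g e = 0")
      case True
      then have "h e = 0" using h[OF that] by auto
      then have "dir_sign R e = dir_sign \<sigma> e" "f e = 0" using True that by (auto simp: R_def f_def dir_sign_def)
      then show ?thesis using x(2)[OF that True] by (simp add: x'_def)
    next
      case False
      then have "1 \<le> f e" using g'(1)[OF that] that by (auto simp: f_def)
      then have "K * 1 \<le> K * f e" using K[OF that] by (intro mult_left_mono) auto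
      moreover have "dir_sign R e * x' e = dir_sign R e * x e + K * f e"
        by (simp add: x'_def dir_sign_def algebra_simps)
      moreover have "- \<bar>x e\<bar> \<le> dir_sign R e * x e" by (auto simp: dir_sign_def)
      ultimately show ?thesis using K[OF that] by linarith
    qed
    ultimately have "rel_cyclic {} E R" unfolding rel_cyclic_def by auto
    moreover have "R \<subseteq> E" using \<sigma> by (auto simp: R_def)
    ultimately show ?thesis by (simp add: totally_cyclic_iff)
  qed
  ultimately show ?thesis by blast
qed

text \<open>Equivalent orientations have equal imbalance, so the correction term of
  \<open>two_net_flip\<close> vanishes.\<close>

lemma flip_in_box_flows:
  assumes "eul_equiv V E ends R1 R2" "f \<in> box_flows R1 q"
  shows "restrict (flip (int q) R1 R2 f) E \<in> box_flows R2 q"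
proof -
  note f = box_flowsD[OF assms(2)]
  have "net (\<lambda>e. dir_sign R2 e * restrict (flip (int q) R1 R2 f) E e) v = 0" if "v \<in> V" for v
  proof -
    have "net (\<lambda>e. dir_sign R2 e * restrict (flip (int q) R1 R2 f) E e) v
        = net (\<lambda>e. dir_sign R2 e * flip (int q) R1 R2 f e) v"
      by (rule net_cong) simp
    then show ?thesis
      using two_net_flip[of R2 "int q" R1 f v] f(3)[OF that] assms(1) that by (auto simp: eul_equiv_iff)
  qed
  moreover have "flip (int q) R1 R2 f e \<in> {0..int q}" if "e \<in> E" for e
    using f(1)[OF that] by (auto simp: flip_def)
  ultimately show ?thesis by (auto simp: box_flows_def int_flow_iff PiE_iff)
qed

text \<open>Surjectivity: lift, then flip to the representative of the class. Injectivity: equal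
  images force \<open>f2\<close> to be the flip of \<open>f1\<close>, hence equal imbalance, and a
  class has a single representative.\<close>

lemma bij_betw_reduce:
  assumes q: "q \<ge> 1" and T: "tc_representatives V E ends T"
  shows "bij_betw (\<lambda>(R, f). (reduce q R f, zero_dirs q R f)) (SIGMA R:T. box_flows R q) (cyclic_mod_flows q)"
proof (rule bij_betwI')
  have Ttc: "totally_cyclic V E ends R" if "R \<in> T" for R
    using T that by (auto simp: tc_representatives_def tc_orientations_def)
  have TE: "R \<subseteq> E" if "R \<in> T" for R using Ttc[OF that] by (simp add: totally_cyclic_iff)
  {
    fix p assume "p \<in> (SIGMA R:T. box_flows R q)"
    then show "(case p of (R, f) \<Rightarrow> (reduce q R f, zero_dirs q R f)) \<in> cyclic_mod_flows q"
      using reduce_in_cyclic_mod_flows[OF q] Ttc by auto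
  next
    fix p assume "p \<in> cyclic_mod_flows q"
    then obtain g \<sigma> where p: "p = (g, \<sigma>)" "(g, \<sigma>) \<in> cyclic_mod_flows q" by (cases p) auto
    obtain R f where R: "totally_cyclic V E ends R" "f \<in> box_flows R q" "reduce q R f = g" "zero_dirs q R f = \<sigma>"
      using lift_mod_flow[OF q p(2)] by auto
    then obtain R' where R': "R' \<in> T" "eul_equiv V E ends R R'"
      using T by (auto simp: tc_representatives_def tc_orientations_def)
    let ?f = "restrict (flip (int q) R R' f) E"
    have "?f \<in> box_flows R' q" by (rule flip_in_box_flows[OF R'(2) R(2)])
    moreover have "reduce q R' ?f = g"
      unfolding R(3)[symmetric] by (rule ext) (auto simp: reduce_def flip_def)
    moreover have "zero_dirs q R' ?f = \<sigma>"
      unfolding R(4)[symmetric] using q by (auto simp: zero_dirs_def flip_def)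
    ultimately show "\<exists>p'\<in>(SIGMA R:T. box_flows R q). p = (case p' of (R, f) \<Rightarrow> (reduce q R f, zero_dirs q R f))"
      using R'(1) p(1) by (intro bexI[of _ "(R', ?f)"]) auto
  next
    fix p1 p2 assume "p1 \<in> (SIGMA R:T. box_flows R q)" "p2 \<in> (SIGMA R:T. box_flows R q)"
    then obtain R1 f1 R2 f2 where p: "p1 = (R1, f1)" "p2 = (R2, f2)"
      and R: "R1 \<in> T" "R2 \<in> T" and f: "f1 \<in> box_flows R1 q" "f2 \<in> box_flows R2 q" by auto
    have "(R1, f1) = (R2, f2)" if eq: "reduce q R1 f1 = reduce q R2 f2" "zero_dirs q R1 f1 = zero_dirs q R2 f2"
    proof -
      note f1 = box_flowsD[OF f(1)] and f2 = box_flowsD[OF f(2)]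
      have f2_eq: "f2 e = flip (int q) R1 R2 f1 e" if "e \<in> E" for e
      proof -
        have "reduce q R1 f1 e = reduce q R2 f2 e" "e \<in> zero_dirs q R1 f1 \<longleftrightarrow> e \<in> zero_dirs q R2 f2"
          using eq by auto
        then show ?thesis using that f1(1)[OF that] f2(1)[OF that] q
          by (auto simp: reduce_def zero_dirs_def flip_def split: if_splits)
      qed
      have "net (dir_sign R1) v = net (dir_sign R2) v" if "v \<in> V" for v
      proof -
        have "net (\<lambda>e. dir_sign R2 e * flip (int q) R1 R2 f1 e) v = net (\<lambda>e. dir_sign R2 e * f2 e) v"
          by (rule net_cong) (simp add: f2_eq)
        \<comment> \<open>Both flows are conserved, so \<open>two_net_flip\<close> leaves q times
          the difference of the imbalances equal to 0.\<close>
        then show ?thesis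
          using two_net_flip[of R2 "int q" R1 f1 v] f1(3)[OF that] f2(3)[OF that] q by auto
      qed
      then have "eul_equiv V E ends R1 R2" "eul_equiv V E ends R1 R1"
        using TE R by (auto simp: eul_equiv_iff)
      moreover have "R1 \<in> tc_orientations V E ends" using Ttc R by (auto simp: tc_orientations_def)
      ultimately have RR: "R1 = R2" using T R unfolding tc_representatives_def by blast
      then have "f1 e = f2 e" for e
        using f2_eq[of e] f1(2)[of e] f2(2)[of e] by (cases "e \<in> E") (auto simp: flip_def)
      then show ?thesis using RR by auto
    qed
    then show "((case p1 of (R, f) \<Rightarrow> (reduce q R f, zero_dirs q R f)) = (case p2 of (R, f) \<Rightarrow> (reduce q R f, zero_dirs q R f)))
        = (p1 = p2)"
      using p by auto
  }
qed

lemma finite_representatives: "tc_representatives V E ends T \<Longrightarrow> finite T"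
  by (rule finite_subset[of _ "Pow E"])
    (auto simp: tc_representatives_def tc_orientations_def totally_cyclic_def orientations_def)

lemma phi_rho_eq_card:
  "phi_rho V E ends R q = card {f \<in> box_flows R q. \<forall>e\<in>E. f e \<noteq> 0 \<and> f e \<noteq> int q}"
  unfolding phi_rho_def box_flows_def
  by (intro arg_cong[where f = card]) (fastforce simp: PiE_iff)

text \<open>The bijection restricts to flows avoiding both 0 and q, which correspond to
  \<open>g\<close> without zeros; then \<open>\<sigma> = {}\<close> is the only choice.\<close>

lemma nzflow_count_eq_sum:
  assumes q: "q \<ge> 1" and T: "tc_representatives V E ends T"
  shows "nzflow_count V E ends q = (\<Sum>R\<in>T. phi_rho V E ends R q)"
proof -
  let ?\<Phi> = "\<lambda>(R, f). (reduce q R f, zero_dirs q R f)"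
  let ?A = "{p \<in> (SIGMA R:T. box_flows R q). \<forall>e\<in>E. snd p e \<noteq> 0 \<and> snd p e \<noteq> int q}"
  let ?B = "{p \<in> cyclic_mod_flows q. \<forall>e\<in>E. fst p e \<noteq> 0}"
  note bij = bij_betw_reduce[OF q T]
  have "bij_betw ?\<Phi> ?A ?B"
  proof (rule bij_betw_subset[OF bij])
    have iff: "(\<forall>e\<in>E. fst (?\<Phi> p) e \<noteq> 0) \<longleftrightarrow> (\<forall>e\<in>E. snd p e \<noteq> 0 \<and> snd p e \<noteq> int q)" for p
      by (cases p) (auto simp: reduce_def)
    have im: "?\<Phi> ` (SIGMA R:T. box_flows R q) = cyclic_mod_flows q"
      using bij by (rule bij_betw_imp_surj_on)
    show "?\<Phi> ` ?A = ?B" unfolding im[symmetric] using iff by (auto simp del: split_paired_All)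
  qed auto
  then have "card ?A = card ?B" by (rule bij_betw_same_card)
  also have "?B = {g \<in> mod_flows q. \<forall>e\<in>E. g e \<noteq> 0} \<times> {{}}"
  proof -
    have "rel_cyclic {e \<in> E. g e \<noteq> 0} {e \<in> E. g e = 0} {}" if "\<forall>e\<in>E. g e \<noteq> 0" for g :: "'e \<Rightarrow> int"
      unfolding rel_cyclic_def using that by (intro exI[of _ "\<lambda>_. 0"]) auto
    then show ?thesis unfolding cyclic_mod_flows_def by auto
  qed
  also have "card \<dots> = nzflow_count V E ends q"
    by (simp add: card_cartesian_product nzflow_count_eq_card[OF q])
  also have "?A = (SIGMA R:T. {f \<in> box_flows R q. \<forall>e\<in>E. f e \<noteq> 0 \<and> f e \<noteq> int q})"
    by auto
  also have "card \<dots> = (\<Sum>R\<in>T. card {f \<in> box_flows R q. \<forall>e\<in>E. f e \<noteq> 0 \<and> f e \<noteq> int q})"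
    using finite_representatives[OF T] by (intro card_SigmaI) auto
  also have "\<dots> = (\<Sum>R\<in>T. phi_rho V E ends R q)"
    by (simp add: phi_rho_eq_card)
  finally show ?thesis by simp
qed

lemma phibar_eq_sum:
  "tc_representatives V E ends T \<Longrightarrow> phibar V E ends T q = (\<Sum>R\<in>T. phibar_rho V E ends R q)"
  unfolding phibar_def phibar_rho_def using finite_representatives finite_box_flows
  by (intro card_SigmaI) (auto simp: box_flows_def)

text \<open>For each \<open>g\<close> the admissible \<open>\<sigma>\<close> are counted by
  \<open>card_rel_cyclic\<close> with the support of \<open>g\<close> contracted. Exchanging sums
  leaves the flows vanishing on \<open>W\<close>, which number a power of q.\<close>

lemma phibar_eq_flow_poly:
  assumes q: "q \<ge> 1" and T: "tc_representatives V E ends T"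
  shows "of_nat (phibar V E ends T q) = (-1) ^ nullity E * poly flow_poly (- of_nat q)"
proof -
  have "phibar V E ends T q = card (cyclic_mod_flows q)"
    using bij_betw_same_card[OF bij_betw_reduce[OF q T]] by (simp add: phibar_def box_flows_def)
  also have "\<dots> = (\<Sum>g\<in>mod_flows q. card {\<sigma> \<in> Pow {e\<in>E. g e = 0}. rel_cyclic {e\<in>E. g e \<noteq> 0} {e\<in>E. g e = 0} \<sigma>})"
    unfolding cyclic_mod_flows_def by (intro card_SigmaI) auto
  finally have "int (phibar V E ends T q) = (\<Sum>g\<in>mod_flows q. int (card {\<sigma> \<in> Pow {e\<in>E. g e = 0}. rel_cyclic {e\<in>E. g e \<noteq> 0} {e\<in>E. g e = 0} \<sigma>}))"
    by simp
  also have "\<dots> = (\<Sum>g\<in>mod_flows q. \<Sum>W\<in>Pow {e\<in>E. g e = 0}. (-1) ^ (card W + nullity E + nullity (E - W)))"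
  proof (intro sum.cong refl)
    fix g :: "'e \<Rightarrow> int"
    have "{e\<in>E. g e \<noteq> 0} \<union> {e\<in>E. g e = 0} = E" by auto
    then show "int (card {\<sigma> \<in> Pow {e\<in>E. g e = 0}. rel_cyclic {e\<in>E. g e \<noteq> 0} {e\<in>E. g e = 0} \<sigma>})
        = (\<Sum>W\<in>Pow {e\<in>E. g e = 0}. (-1) ^ (card W + nullity E + nullity (E - W)))"
      using card_rel_cyclic[of "{e\<in>E. g e \<noteq> 0}" "{e\<in>E. g e = 0}"] by auto
  qed
  \<comment> \<open>The indicator makes the range of \<open>W\<close> independent of
    \<open>g\<close>, so that the sums can be exchanged.\<close>
  also have "\<dots> = (\<Sum>g\<in>mod_flows q. \<Sum>W\<in>Pow E. (-1) ^ (card W + nullity E + nullity (E - W)) * of_bool (\<forall>e\<in>W. g e = 0))"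
    by (intro sum.cong refl sum.mono_neutral_cong_left) auto
  also have "\<dots> = (\<Sum>W\<in>Pow E. \<Sum>g\<in>mod_flows q. (-1) ^ (card W + nullity E + nullity (E - W)) * of_bool (\<forall>e\<in>W. g e = 0))"
    by (rule sum.swap)
  also have "\<dots> = (\<Sum>W\<in>Pow E. (-1) ^ (card W + nullity E + nullity (E - W)) * int q ^ nullity (E - W))"
  proof (intro sum.cong refl)
    fix W assume W: "W \<in> Pow E"
    have "(\<Sum>g\<in>mod_flows q. of_bool (\<forall>e\<in>W. g e = 0) :: int) = int (card {g \<in> mod_flows q. \<forall>e\<in>W. g e = 0})"
      by (rule of_nat_card_filter[symmetric]) simp
    then show "(\<Sum>g\<in>mod_flows q. (-1) ^ (card W + nullity E + nullity (E - W)) * of_bool (\<forall>e\<in>W. g e = 0))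
      = (-1) ^ (card W + nullity E + nullity (E - W)) * int q ^ nullity (E - W)"
      using W by (simp only: sum_distrib_left[symmetric] card_mod_flows_vanishing[OF q] Pow_iff of_nat_power)
  qed
  finally have "of_int (int (phibar V E ends T q))
      = (of_int (\<Sum>W\<in>Pow E. (-1) ^ (card W + nullity E + nullity (E - W)) * int q ^ nullity (E - W)) :: rat)"
    by (rule arg_cong)
  then have "of_nat (phibar V E ends T q)
      = (\<Sum>W\<in>Pow E. (-1) ^ (card W + nullity E + nullity (E - W)) * of_nat q ^ nullity (E - W) :: rat)"
    by simp
  \<comment> \<open>The sign with exponent \<open>nullity (E - W)\<close> is absorbed into the
    power, turning q into -q.\<close>
  also have "\<dots> = (-1) ^ nullity E * poly flow_poly (- of_nat q)"
    unfolding poly_flow_poly sum_distrib_left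
    by (intro sum.cong refl) (simp add: power_add power_minus[of "of_nat q"])
  finally show ?thesis .
qed

lemma card_tc_orientations:
  "of_nat (card (tc_orientations V E ends)) = (-1) ^ nullity E * poly flow_poly (-1)"
proof -
  have "tc_orientations V E ends = {\<sigma> \<in> Pow E. rel_cyclic {} E \<sigma>}"
    by (auto simp: tc_orientations_def totally_cyclic_iff)
  then have "int (card (tc_orientations V E ends)) = (\<Sum>W\<in>Pow E. (-1) ^ (card W + nullity E + nullity (E - W)))"
    using card_rel_cyclic[of "{}" E] by simp
  then have "of_int (int (card (tc_orientations V E ends)))
      = (of_int (\<Sum>W\<in>Pow E. (-1) ^ (card W + nullity E + nullity (E - W))) :: rat)"
    by (rule arg_cong)
  then show ?thesis
    by (simp add: poly_flow_poly sum_distrib_left power_add mult_ac)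
qed

end

subsection \<open>Polynomiality of the orientation-wise counts\<close>

text \<open>Sums of powers are polynomials: the binomial expansion of \<open>(x - 1) ^ Suc n\<close>
  expresses \<open>x ^ n\<close> by a difference and lower powers.\<close>

lemma power_antidifference: "\<exists>s :: 'a::field_char_0 poly. \<forall>x. poly s x - poly s (x - 1) = x ^ n"
proof (induction n rule: less_induct)
  case (less n)
  then obtain s :: "nat \<Rightarrow> 'a poly" where s: "\<And>k x. k < n \<Longrightarrow> poly (s k) x - poly (s k) (x - 1) = x ^ k"
    by metis
  define c :: "nat \<Rightarrow> 'a" where "c k = of_nat (Suc n choose k) * (-1) ^ (Suc n - k)" for k
  define t where "t = smult (1 / of_nat (Suc n)) (monom 1 (Suc n) + (\<Sum>k<n. smult (c k) (s k)))"
  have "poly t x - poly t (x - 1) = x ^ n" for x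
  proof -
    have "(x - 1) ^ Suc n = (\<Sum>k\<le>Suc n. of_nat (Suc n choose k) * x ^ k * (-1) ^ (Suc n - k))"
      using binomial_ring[of x "-1" "Suc n"] by simp
    also have "\<dots> = (\<Sum>k\<le>Suc n. c k * x ^ k)" by (intro sum.cong) (auto simp: c_def)
    also have "\<dots> = (\<Sum>k<n. c k * x ^ k) - of_nat (Suc n) * x ^ n + x ^ Suc n"
      by (simp add: c_def lessThan_Suc_atMost[symmetric] algebra_simps)
    finally have "x ^ Suc n - (x - 1) ^ Suc n + (\<Sum>k<n. c k * x ^ k) = of_nat (Suc n) * x ^ n"
      by simp
    moreover have "poly t x - poly t (x - 1)
       = (x ^ Suc n - (x - 1) ^ Suc n + (\<Sum>k<n. c k * (poly (s k) x - poly (s k) (x - 1)))) / of_nat (Suc n)"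
      by (simp add: t_def poly_sum poly_monom diff_divide_distrib[symmetric] right_diff_distrib sum_subtractf
          del: power_Suc of_nat_Suc)
    ultimately show ?thesis using s by (simp del: power_Suc of_nat_Suc)
  qed
  then show ?case by blast
qed

lemma poly_antidifference:
  fixes r :: "'a::field_char_0 poly"
  shows "\<exists>s. \<forall>x. poly s x - poly s (x - 1) = poly r x"
proof -
  obtain s :: "nat \<Rightarrow> 'a poly" where s: "\<And>n x. poly (s n) x - poly (s n) (x - 1) = x ^ n"
    using power_antidifference by metis
  have "poly (\<Sum>i\<le>degree r. smult (coeff r i) (s i)) x - poly (\<Sum>i\<le>degree r. smult (coeff r i) (s i)) (x - 1) = poly r x" for x
  proof -
    have "poly (\<Sum>i\<le>degree r. smult (coeff r i) (s i)) x - poly (\<Sum>i\<le>degree r. smult (coeff r i) (s i)) (x - 1)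
      = (\<Sum>i\<le>degree r. coeff r i * (poly (s i) x - poly (s i) (x - 1)))"
      by (simp add: poly_sum right_diff_distrib sum_subtractf)
    also have "\<dots> = poly r x" by (simp add: s poly_altdef[of r])
    finally show ?thesis .
  qed
  then show ?thesis by blast
qed

text \<open>The differences are evaluated at \<open>Suc n\<close>, hence only at positive arguments,
  yet the resulting polynomial is also correct at 0.\<close>

lemma polynomial_of_polynomial_differences:
  fixes a :: "nat \<Rightarrow> 'a::field_char_0"
  assumes "\<And>n. a (Suc n) - a n = poly r (of_nat (Suc n))"
  shows "\<exists>p. \<forall>n. a n = poly p (of_nat n)"
proof -
  obtain s where s: "\<And>x. poly s x - poly s (x - 1) = poly r x" using poly_antidifference by blast
  have "a n = poly (s + [:a 0 - poly s 0:]) (of_nat n)" for n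
  proof (induction n)
    case (Suc n)
    then show ?case using assms[of n] s[of "of_nat (Suc n)"] by (simp add: algebra_simps)
  qed simp
  then show ?thesis by blast
qed

lemma poly_eqI_nat:
  fixes p q :: "'a::field_char_0 poly"
  assumes "\<And>n. n \<ge> 1 \<Longrightarrow> poly p (of_nat n) = poly q (of_nat n)"
  shows "p = q"
proof (rule ccontr)
  assume "p \<noteq> q"
  then have "finite {x. poly (p - q) x = 0}" by (intro poly_roots_finite) simp
  moreover have "of_nat ` {1..} \<subseteq> {x. poly (p - q) x = 0}" using assms by auto
  ultimately have "finite (of_nat ` {1..} :: 'a set)" by (rule finite_subset[rotated])
  then have "finite {1::nat..}" by (rule finite_imageD) (auto simp: inj_on_def)
  then show False using infinite_Ici by blast
qed

section \<open>Lattice points in faces of the flow polytope\<close>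

context multigraph
begin

text \<open>A face of the dilated polytope, with \<open>A\<close> at the lower bound and
  \<open>B\<close> at the upper one.\<close>

definition face :: "'e set \<Rightarrow> 'e set \<Rightarrow> 'e set \<Rightarrow> nat \<Rightarrow> ('e \<Rightarrow> int) set" where
  "face R A B q = {f \<in> box_flows R q. (\<forall>e\<in>A. f e = 0) \<and> (\<forall>e\<in>B. f e = int q)}"

lemma finite_face [simp]: "finite (face R A B q)"
  by (simp add: face_def)

lemma face_0:
  assumes "A \<subseteq> E" "B \<subseteq> E"
  shows "face R A B 0 = {\<lambda>e\<in>E. 0}"
proof -
  have "net (\<lambda>e. dir_sign R e * restrict (\<lambda>_. 0) E e) v = 0" for v
    by (subst net_cong[of _ "\<lambda>_. 0"]) auto
  then show ?thesis using assms
    by (auto simp: face_def box_flows_def int_flow_iff PiE_iff extensional_def fun_eq_iff)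
qed

text \<open>This is the integrality of the face polytopes.\<close>

lemma face_nonempty_imp_vertex:
  assumes q: "q \<ge> 1" and AB: "A \<subseteq> E" "B \<subseteq> E" and f: "f \<in> face R A B q"
  shows "face R A B 1 \<noteq> {}"
proof -
  have f0: "f \<in> box_flows R q" "\<And>e. e \<in> A \<Longrightarrow> f e = 0" "\<And>e. e \<in> B \<Longrightarrow> f e = int q"
    using f by (auto simp: face_def)
  note f1 = box_flowsD[OF f0(1)]
  define g where "g e = dir_sign R e * f e" for e
  have "int q > 0" using q by simp
  then have "\<exists>z :: 'e \<Rightarrow> int. (\<forall>e\<in>E. \<lfloor>of_int (g e) / of_int (int q) :: rat\<rfloor> \<le> z e \<and> z e \<le> \<lceil>of_int (g e) / of_int (int q) :: rat\<rceil>)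
      \<and> (\<forall>v\<in>V. int q * net z v = net g v)"
    by (rule integral_rounding_scaled) (simp add: g_def f1)
  then obtain z :: "'e \<Rightarrow> int" where
    z0: "\<forall>e\<in>E. \<lfloor>of_int (g e) / of_int (int q) :: rat\<rfloor> \<le> z e \<and> z e \<le> \<lceil>of_int (g e) / of_int (int q) :: rat\<rceil>"
    and z1: "\<forall>v\<in>V. int q * net z v = net g v"
    by (elim exE conjE)
  \<comment> \<open>Undoing the signs turns the rounding of \<open>g / q\<close> into a rounding of
    \<open>f / q\<close>; coordinates that are already 0 or 1 stay fixed.\<close>
  define v where "v = (\<lambda>e\<in>E. dir_sign R e * z e)"
  have v: "0 \<le> v e \<and> v e \<le> 1 \<and> (f e = 0 \<longrightarrow> v e = 0) \<and> (f e = int q \<longrightarrow> v e = 1)" if e: "e \<in> E" for e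
  proof -
    define x :: rat where "x = of_int (f e) / of_int (int q)"
    have "rat_of_int (f e) \<le> rat_of_int (int q)" using f1(1)[OF e] by (simp only: of_int_le_iff)
    then have x: "0 \<le> x" "x \<le> 1" "f e = 0 \<Longrightarrow> x = 0" "f e = int q \<Longrightarrow> x = 1"
      using f1(1)[OF e] q by (simp_all add: x_def divide_le_eq_1)
    have gx: "of_int (g e) / of_int (int q) = of_int (dir_sign R e) * x" by (simp add: g_def x_def)
    have "\<lfloor>x\<rfloor> \<le> v e \<and> v e \<le> \<lceil>x\<rceil>"
    proof (cases "e \<in> R")
      case True
      then have "- \<lceil>x\<rceil> \<le> z e" "z e \<le> - \<lfloor>x\<rfloor>" using bspec[OF z0 e] unfolding gx
        by (simp_all add: dir_sign_def floor_minus ceiling_minus)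
      then show ?thesis using True e by (simp add: v_def dir_sign_def)
    next
      case False
      then show ?thesis using bspec[OF z0 e] e unfolding gx by (simp add: v_def dir_sign_def)
    qed
    moreover have "0 \<le> \<lfloor>x\<rfloor>" "\<lceil>x\<rceil> \<le> 1" using x by (auto simp: ceiling_le_iff)
    moreover have "\<lceil>x\<rceil> = 0" if "f e = 0" using x(3)[OF that] by simp
    moreover have "\<lfloor>x\<rfloor> = 1" if "f e = int q" using x(4)[OF that] by simp
    ultimately show ?thesis by linarith
  qed
  have "net (\<lambda>e. dir_sign R e * v e) u = 0" if "u \<in> V" for u
  proof -
    have "net (\<lambda>e. dir_sign R e * v e) u = net z u" by (rule net_cong) (simp add: v_def)
    moreover have "net g u = 0" using f1(3)[OF that] by (simp add: g_def[abs_def])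
    ultimately show ?thesis using bspec[OF z1 that] q by simp
  qed
  then have "v \<in> box_flows R 1" using v by (auto simp: box_flows_def int_flow_iff PiE_iff v_def)
  then have "v \<in> face R A B 1" using v AB f0(2,3) by (auto simp: face_def)
  then show ?thesis by auto
qed

text \<open>Subtracting a vertex v maps the points of level q + 1 that lie on no facet avoiding v
  onto the points of level q.\<close>

lemma card_face_pulling:
  assumes AB: "A \<subseteq> E" "B \<subseteq> E" and v: "v \<in> face R A B 1"
  shows "card (face R A B q)
    = card {f \<in> face R A B (Suc q). \<forall>e\<in>E - (A \<union> B). f e \<noteq> int (Suc q) * (1 - v e)}"
proof (rule bij_betw_same_card[symmetric])
  \<comment> \<open>\<open>int (Suc q) * (1 - v e)\<close> is the bound opposite to
    \<open>v\<close>: the top value where \<open>v e = 0\<close>, and 0 where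
    \<open>v e = 1\<close>. Avoiding it keeps \<open>f e - v e\<close> between 0 and q.\<close>
  let ?S = "{f \<in> face R A B (Suc q). \<forall>e\<in>E - (A \<union> B). f e \<noteq> int (Suc q) * (1 - v e)}"
  have v0: "v \<in> box_flows R 1" "\<And>e. e \<in> A \<Longrightarrow> v e = 0" "\<And>e. e \<in> B \<Longrightarrow> v e = 1"
    using v by (auto simp: face_def)
  have v1: "v e = 0 \<or> v e = 1" if "e \<in> E" for e using box_flowsD(1)[OF v0(1) that] by auto
  have net_v: "net (\<lambda>e. dir_sign R e * v e) u = 0" if "u \<in> V" for u
    by (rule box_flowsD(3)[OF v0(1) that])
  show "bij_betw (\<lambda>f. \<lambda>e\<in>E. f e - v e) ?S (face R A B q)"
  proof (rule bij_betw_byWitness[where f' = "\<lambda>f. \<lambda>e\<in>E. f e + v e"])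
    show "\<forall>f\<in>?S. (\<lambda>e\<in>E. (\<lambda>e\<in>E. f e - v e) e + v e) = f"
      using box_flowsD(2) by (fastforce simp: fun_eq_iff restrict_def face_def)
    show "\<forall>f\<in>face R A B q. (\<lambda>e\<in>E. (\<lambda>e\<in>E. f e + v e) e - v e) = f"
      using box_flowsD(2) by (fastforce simp: fun_eq_iff restrict_def face_def)
    show "(\<lambda>f. \<lambda>e\<in>E. f e - v e) ` ?S \<subseteq> face R A B q"
    proof (rule image_subsetI)
      fix f assume f: "f \<in> ?S"
      then have f0: "f \<in> box_flows R (Suc q)" by (simp add: face_def)
      have "f e - v e \<in> {0..int q}" if "e \<in> E" for e
      proof -
        consider "e \<in> A" | "e \<in> B" | "e \<in> E - (A \<union> B)" using \<open>e \<in> E\<close> by blast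
        then show ?thesis
        proof cases
          case 3
          then have "f e \<noteq> int (Suc q) * (1 - v e)" using f by blast
          then show ?thesis using v1[OF that] box_flowsD(1)[OF f0 that] by auto
        qed (use f v0(2,3)[of e] in \<open>auto simp: face_def\<close>)
      qed
      moreover have "net (\<lambda>e. dir_sign R e * (\<lambda>e\<in>E. f e - v e) e) u = 0" if "u \<in> V" for u
      proof -
        have "net (\<lambda>e. dir_sign R e * (\<lambda>e\<in>E. f e - v e) e) u
            = net (\<lambda>e. dir_sign R e * f e - dir_sign R e * v e) u"
          by (rule net_cong) (simp add: algebra_simps)
        then show ?thesis using net_v[OF that] box_flowsD(3)[OF f0 that] by (simp add: net_diff)
      qed
      ultimately have "(\<lambda>e\<in>E. f e - v e) \<in> box_flows R q" by (auto simp: box_flows_def int_flow_iff PiE_iff)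
      then show "(\<lambda>e\<in>E. f e - v e) \<in> face R A B q" using AB f v0 by (auto simp: face_def)
    qed
    show "(\<lambda>f. \<lambda>e\<in>E. f e + v e) ` face R A B q \<subseteq> ?S"
    proof (rule image_subsetI)
      fix f assume f: "f \<in> face R A B q"
      then have f0: "f \<in> box_flows R q" by (simp add: face_def)
      have "f e + v e \<in> {0..int (Suc q)}" if "e \<in> E" for e
        using v1[OF that] box_flowsD(1)[OF f0 that] by auto
      moreover have "net (\<lambda>e. dir_sign R e * (\<lambda>e\<in>E. f e + v e) e) u = 0" if "u \<in> V" for u
      proof -
        have "net (\<lambda>e. dir_sign R e * (\<lambda>e\<in>E. f e + v e) e) u
            = net (\<lambda>e. dir_sign R e * f e + dir_sign R e * v e) u"
          by (rule net_cong) (simp add: algebra_simps)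
        then show ?thesis using net_v[OF that] box_flowsD(3)[OF f0 that] by (simp add: net_add)
      qed
      ultimately have "(\<lambda>e\<in>E. f e + v e) \<in> box_flows R (Suc q)" by (auto simp: box_flows_def int_flow_iff PiE_iff)
      then have "(\<lambda>e\<in>E. f e + v e) \<in> face R A B (Suc q)" using AB f v0 by (auto simp: face_def)
      moreover have "f e + v e \<noteq> int (Suc q) * (1 - v e)" if "e \<in> E" for e
        using v1[OF that] box_flowsD(1)[OF f0 that] by auto
      ultimately show "(\<lambda>e\<in>E. f e + v e) \<in> ?S" by simp
    qed
  qed
qed

text \<open>Induction on the number of coordinates not fixed. A face without a point at level 1 is
  empty at all positive levels but still contains the zero flow at level 0, which is why the value
  at 0 is claimed conditionally.\<close>

lemma card_face_polynomial:
  assumes "A \<subseteq> E" "B \<subseteq> E"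
  shows "\<exists>p :: rat poly. (\<forall>q\<ge>1. of_nat (card (face R A B q)) = poly p (of_nat q))
    \<and> (face R A B 1 \<noteq> {} \<longrightarrow> of_nat (card (face R A B 0)) = poly p 0)"
  using assms
proof (induction "card (E - (A \<union> B))" arbitrary: A B rule: less_induct)
  case less
  note AB = less.prems
  show ?case
  proof (cases "face R A B 1 = {}")
    case True
    then have "face R A B q = {}" if "q \<ge> 1" for q
      using face_nonempty_imp_vertex[OF that AB] by blast
    then show ?thesis using True by (intro exI[of _ 0]) auto
  next
    case False
    then obtain v where v: "v \<in> face R A B 1" by auto
    have v1: "v e = 0 \<or> v e = 1" if "e \<in> E" for e
      using v box_flowsD(1)[of v R 1 e] that by (auto simp: face_def)
    define U where "U = E - (A \<union> B)"
    \<comment> \<open>The intersection of the facets avoiding \<open>v\<close> in the directions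
      \<open>W\<close> is again a face, with every edge of \<open>W\<close> fixed opposite to
      \<open>v\<close>.\<close>
    define A' where "A' W = A \<union> {e\<in>W. v e = 1}" for W
    define B' where "B' W = B \<union> {e\<in>W. v e = 0}" for W
    have face': "{f \<in> face R A B q. \<forall>e\<in>W. f e = int q * (1 - v e)} = face R (A' W) (B' W) q" if "W \<subseteq> U" for W q
    proof -
      have "(\<forall>e\<in>W. f e = int q * (1 - v e)) \<longleftrightarrow> (\<forall>e\<in>W. (v e = 1 \<longrightarrow> f e = 0) \<and> (v e = 0 \<longrightarrow> f e = int q))" for f
      proof (intro ball_cong refl)
        fix e assume "e \<in> W"
        then have "v e = 0 \<or> v e = 1" using that v1 by (auto simp: U_def)
        then show "f e = int q * (1 - v e) \<longleftrightarrow> (v e = 1 \<longrightarrow> f e = 0) \<and> (v e = 0 \<longrightarrow> f e = int q)" by auto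
      qed
      then show ?thesis by (auto simp: face_def A'_def B'_def)
    qed
    have "\<exists>p :: rat poly. \<forall>q\<ge>1. of_nat (card (face R (A' W) (B' W) q)) = poly p (of_nat q)"
      if W: "W \<in> Pow U - {{}}" for W
    proof -
      obtain e where e: "e \<in> W" "e \<in> U" using W by auto
      have "E - (A' W \<union> B' W) \<subset> E - (A \<union> B)"
        using e v1[of e] by (auto simp: A'_def B'_def U_def)
      then have "card (E - (A' W \<union> B' W)) < card (E - (A \<union> B))" by (intro psubset_card_mono) auto
      moreover have "A' W \<subseteq> E" "B' W \<subseteq> E" using W AB by (auto simp: A'_def B'_def U_def)
      ultimately show ?thesis using less.hyps by blast
    qed
    then obtain p :: "'e set \<Rightarrow> rat poly" where
      p: "\<And>W q. W \<in> Pow U - {{}} \<Longrightarrow> q \<ge> 1 \<Longrightarrow> of_nat (card (face R (A' W) (B' W) q)) = poly (p W) (of_nat q)"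
      by metis
    define r where "r = - (\<Sum>W\<in>Pow U - {{}}. smult ((-1) ^ card W) (p W))"
    have "of_nat (card (face R A B (Suc q))) - of_nat (card (face R A B q)) = poly r (of_nat (Suc q))" for q
    proof -
      have "(of_nat (card (face R A B q)) :: rat)
        = of_nat (card {f \<in> face R A B (Suc q). \<forall>e\<in>U. \<not> f e = int (Suc q) * (1 - v e)})"
        using card_face_pulling[OF AB v, of q] by (simp add: U_def)
      also have "\<dots> = (\<Sum>W\<in>Pow U. (-1) ^ card W * of_nat (card {f \<in> face R A B (Suc q). \<forall>e\<in>W. f e = int (Suc q) * (1 - v e)}))"
        by (rule card_all_not_eq_sum) (auto simp: U_def)
      also have "\<dots> = (\<Sum>W\<in>Pow U. (-1) ^ card W * of_nat (card (face R (A' W) (B' W) (Suc q))))"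
        by (intro sum.cong refl) (simp only: face' Pow_iff)
      \<comment> \<open>The term \<open>W = {}\<close> is the whole face at level
        \<open>Suc q\<close>; the others are covered by the induction hypothesis and give the
        difference polynomial.\<close>
      also have "\<dots> = of_nat (card (face R (A' {}) (B' {}) (Suc q)))
          + (\<Sum>W\<in>Pow U - {{}}. (-1) ^ card W * of_nat (card (face R (A' W) (B' W) (Suc q))))"
        by (subst sum.remove[of _ "{}"]) (auto simp: U_def)
      also have "(\<Sum>W\<in>Pow U - {{}}. (-1) ^ card W * of_nat (card (face R (A' W) (B' W) (Suc q))))
          = - poly r (of_nat (Suc q))"
        unfolding r_def poly_minus minus_minus poly_sum poly_smult
        by (intro sum.cong refl) (simp only: p[of _ "Suc q"])
      finally show ?thesis by (simp add: A'_def B'_def)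
    qed
    from polynomial_of_polynomial_differences[of "\<lambda>q. of_nat (card (face R A B q))", OF this]
    obtain p' :: "rat poly" where p': "\<And>q. of_nat (card (face R A B q)) = poly p' (of_nat q)" by blast
    show ?thesis using p' p'[of 0] by (intro exI[of _ p']) simp
  qed
qed

text \<open>The zero flow lies in the polytope at level 1, so the conditional clause applies and q =
  0 is included.\<close>

lemma phibar_rho_polynomial:
  "\<exists>p :: rat poly. \<forall>q. poly p (of_nat q) = of_nat (phibar_rho V E ends R q)"
proof -
  have eq: "phibar_rho V E ends R q = card (face R {} {} q)" for q
    by (simp add: phibar_rho_def face_def box_flows_def)
  have "net (\<lambda>e. dir_sign R e * restrict (\<lambda>_. 0) E e) v = 0" for v
    by (subst net_cong[of _ "\<lambda>_. 0"]) auto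
  then have "(\<lambda>e\<in>E. 0) \<in> face R {} {} 1"
    by (auto simp: face_def box_flows_def int_flow_iff)
  then have "face R {} {} 1 \<noteq> {}" by blast
  then obtain p :: "rat poly" where p: "\<forall>q\<ge>1. of_nat (card (face R {} {} q)) = poly p (of_nat q)"
    "of_nat (card (face R {} {} 0)) = poly p 0"
    using card_face_polynomial[of "{}" "{}" R] by auto
  have "poly p (of_nat q) = of_nat (phibar_rho V E ends R q)" for q
    using p unfolding eq by (cases "q = 0") auto
  then show ?thesis by blast
qed

lemma phibar_rho_0: "phibar_rho V E ends R 0 = 1"
  using face_0[of "{}" "{}" R] by (simp add: phibar_rho_def face_def box_flows_def)

text \<open>Interior points are counted by inclusion-exclusion over all facets.\<close>

lemma phi_rho_polynomial:
  "\<exists>p :: rat poly. \<forall>q\<ge>1. poly p (of_nat q) = of_nat (phi_rho V E ends R q)"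
proof -
  let ?A = "\<lambda>W. {e. (e, False) \<in> W}" and ?B = "\<lambda>W. {e. (e, True) \<in> W}"
  \<comment> \<open>The pair \<open>(e, False)\<close> stands for the facet with value 0 at
    \<open>e\<close>, and \<open>(e, True)\<close> for the one with value q. Sets containing both
    give faces that are empty for positive q.\<close>
  define U where "U = E \<times> (UNIV :: bool set)"
  have "\<exists>p :: rat poly. \<forall>q\<ge>1. of_nat (card (face R (?A W) (?B W) q)) = poly p (of_nat q)" if "W \<in> Pow U" for W
    using card_face_polynomial[of "?A W" "?B W" R] that by (auto simp: U_def)
  then obtain p :: "('e \<times> bool) set \<Rightarrow> rat poly" where
    p: "\<And>W q. W \<in> Pow U \<Longrightarrow> q \<ge> 1 \<Longrightarrow> of_nat (card (face R (?A W) (?B W) q)) = poly (p W) (of_nat q)"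
    by metis
  have "poly (\<Sum>W\<in>Pow U. smult ((-1) ^ card W) (p W)) (of_nat q) = of_nat (phi_rho V E ends R q)" if q: "q \<ge> 1" for q
  proof -
    have "phi_rho V E ends R q = card {f \<in> box_flows R q. \<forall>(e, b)\<in>U. \<not> f e = (if b then int q else 0)}"
    proof -
      have "(\<forall>(e, b)\<in>U. \<not> f e = (if b then int q else 0)) \<longleftrightarrow> (\<forall>e\<in>E. f e \<noteq> 0 \<and> f e \<noteq> int q)" for f :: "'e \<Rightarrow> int"
        by (auto simp: U_def)
      then show ?thesis unfolding phi_rho_eq_card by simp
    qed
    also have "{f \<in> box_flows R q. \<forall>(e, b)\<in>U. \<not> f e = (if b then int q else 0)}
      = {f \<in> box_flows R q. \<forall>x\<in>U. \<not> f (fst x) = (if snd x then int q else 0)}" by auto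
    also have "of_nat (card \<dots>) = (\<Sum>W\<in>Pow U. (-1) ^ card W *
        of_nat (card {f \<in> box_flows R q. \<forall>x\<in>W. f (fst x) = (if snd x then int q else 0)}) :: rat)"
      by (rule card_all_not_eq_sum) (auto simp: U_def)
    also have "\<dots> = (\<Sum>W\<in>Pow U. (-1) ^ card W * of_nat (card (face R (?A W) (?B W) q)))"
    proof -
      have "{f \<in> box_flows R q. \<forall>x\<in>W. f (fst x) = (if snd x then int q else 0)} = face R (?A W) (?B W) q" for W
        unfolding face_def by (force split: if_splits)
      then show ?thesis by simp
    qed
    also have "\<dots> = poly (\<Sum>W\<in>Pow U. smult ((-1) ^ card W) (p W)) (of_nat q)"
      unfolding poly_sum poly_smult by (intro sum.cong refl) (simp only: p[OF _ q])
    finally show ?thesis by simp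
  qed
  then show ?thesis by blast
qed

end

section \<open>Reciprocity, decomposition and special values\<close>

theorem theorem1p2:
  fixes V :: "'v set" and E :: "'e set" and ends :: "'e \<Rightarrow> 'v \<times> 'v"
    and T :: "'e set set"
  assumes "graph V E ends"
    and "bridgeless V E ends"
    and "tc_representatives V E ends T"
  shows "\<exists>(P :: rat poly) (Q :: rat poly) (Prho :: 'e set \<Rightarrow> rat poly) (Qrho :: 'e set \<Rightarrow> rat poly).
     degree P = cyclomatic V E ends \<and> degree Q = cyclomatic V E ends
   \<and> (\<forall>q::nat. q \<ge> 1 \<longrightarrow> poly P (of_nat q) = of_nat (nzflow_count V E ends q))
   \<and> (\<forall>q::nat. poly Q (of_nat q) = of_nat (phibar V E ends T q))
   \<and> pcompose P [:0, -1:] = smult ((-1) ^ cyclomatic V E ends) Q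
   \<and> (\<forall>\<rho>\<in>T. \<forall>q::nat. q \<ge> 1 \<longrightarrow> poly (Prho \<rho>) (of_nat q) = of_nat (phi_rho V E ends \<rho> q))
   \<and> (\<forall>\<rho>\<in>T. \<forall>q::nat. poly (Qrho \<rho>) (of_nat q) = of_nat (phibar_rho V E ends \<rho> q))
   \<and> P = (\<Sum>\<rho>\<in>T. Prho \<rho>) \<and> Q = (\<Sum>\<rho>\<in>T. Qrho \<rho>)
   \<and> \<bar>poly P (-1)\<bar> = of_nat (card (tc_orientations V E ends))
   \<and> \<bar>poly P 0\<bar> = of_nat (card T)"
proof -
  interpret multigraph V E ends by unfold_locales (rule assms(1))
  note T = assms(3)
  obtain Prho :: "'e set \<Rightarrow> rat poly" where
    Prho: "\<And>\<rho> q. q \<ge> 1 \<Longrightarrow> poly (Prho \<rho>) (of_nat q) = of_nat (phi_rho V E ends \<rho> q)"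
    using phi_rho_polynomial by metis
  obtain Qrho :: "'e set \<Rightarrow> rat poly" where
    Qrho: "\<And>\<rho> q. poly (Qrho \<rho>) (of_nat q) = of_nat (phibar_rho V E ends \<rho> q)"
    using phibar_rho_polynomial by metis
  define Q where "Q = (\<Sum>\<rho>\<in>T. Qrho \<rho>)"
  have Q: "poly Q (of_nat q) = of_nat (phibar V E ends T q)" for q
    by (simp add: Q_def poly_sum Qrho phibar_eq_sum[OF T])
  have P: "flow_poly = (\<Sum>\<rho>\<in>T. Prho \<rho>)"
    by (rule poly_eqI_nat) (simp add: poly_sum Prho poly_flow_poly_eq_nzflow_count nzflow_count_eq_sum[OF _ T])
  have sgn2: "(-1) ^ nullity E * ((-1) ^ nullity E * x) = x" for x :: rat
    by (simp add: mult.assoc[symmetric] power_mult_distrib[symmetric])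
  \<comment> \<open>Agreement at positive integers suffices for an identity of polynomials.\<close>
  have rec: "pcompose flow_poly [:0, -1:] = smult ((-1) ^ nullity E) Q"
    by (rule poly_eqI_nat) (simp add: poly_pcompose Q phibar_eq_flow_poly[OF _ T] sgn2)
  have deg: "degree flow_poly = nullity E" by (rule degree_flow_poly[OF assms(2)])
  \<comment> \<open>Substituting -t preserves the degree, so reciprocity transfers it from the flow
    polynomial to \<open>Q\<close>.\<close>
  have "degree Q = degree (smult ((-1) ^ nullity E) Q)" by simp
  also have "\<dots> = nullity E" unfolding rec[symmetric] by (simp add: degree_pcompose deg)
  finally have degQ: "degree Q = nullity E" .
  have tc: "\<bar>poly flow_poly (-1)\<bar> = of_nat (card (tc_orientations V E ends))"
    unfolding card_tc_orientations[THEN arg_cong[where f = abs], unfolded abs_of_nat]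
    by (simp add: abs_mult power_abs)
  have classes: "\<bar>poly flow_poly 0\<bar> = of_nat (card T)"
  proof -
    have "poly flow_poly 0 = (-1) ^ nullity E * poly Q 0"
      using arg_cong[OF rec, of "\<lambda>p. poly p 0"] by (simp add: poly_pcompose)
    \<comment> \<open>At level 0 each representative carries only the zero flow.\<close>
    moreover have "poly Q 0 = of_nat (card T)"
      using Q[of 0] by (simp add: phibar_eq_sum[OF T] phibar_rho_0)
    ultimately show ?thesis by (simp add: abs_mult power_abs)
  qed
  show ?thesis
    by (intro exI[of _ flow_poly] exI[of _ Q] exI[of _ Prho] exI[of _ Qrho] conjI allI impI ballI
        deg degQ Q P rec tc classes Q_def Prho Qrho poly_flow_poly_eq_nzflow_count)
qed

end
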